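(* Let $K$ be an algebraically closed field, $n\ge 2$, and let $A=(A_1,\dots,A_n)$ be an $n$-tuple of $3\times 4$-matrices of rank $3$ over $K$. If $A$ is generic, then the maximal minors of the matrices $A_\sigma$, where $\sigma$ ranges over all subsets of $\{1,\dots,n\}$ with $2\le|\sigma|\le 4$, form a universal Gröbner basis of the multiview ideal $J_A$.
   Context: $\mathbb{P}^r$ denotes projective $r$-space over $K$. $K[x,y,z]$ is the polynomial ring in the $3n$ unknowns $x_i,y_i,z_i$ ($1\le i\le n$), where $(x_i:y_i:z_i)$ are the coordinates on the $i$-th factor of $(\mathbb{P}^2)^n$. The multiview variety $V_A\subset(\mathbb{P}^2)^n$ is the closure of the image of the rational map $\phi_A:\mathbb{P}^3\dashrightarrow(\mathbb{P}^2)^n$, $\mathbf{x}\mapsto(A_1\mathbf{x},\dots,A_n\mathbf{x})$. The multiview ideal $J_A\subset K[x,y,z]$ is the prime ideal of all polynomials vanishing on $V_A$. The configuration $A$ is called generic if all $4\times4$-minors of the $4\times 3n$-matrix $[A_1^T\ A_2^T\ \cdots\ A_n^T]$ are non-zero. Write $p_i=[x_i\ y_i\ z_i]^T$. For $\sigma=\{\sigma_1,\dots,\sigma_s\}\subseteq\{1,\dots,n\}$, $A_\sigma$ is the $3s\times(s+4)$-matrix $$A_\sigma=\begin{bmatrix} A_{\sigma_1} & p_{\sigma_1} & \mathbf 0 & \cdots & \mathbf 0 \\ A_{\sigma_2} & \mathbf 0 & p_{\sigma_2} & \ddots & \mathbf 0 \\ \vdots & \vdots & \ddots & \ddots & \vdots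 \\ A_{\sigma_s} & \mathbf 0 & \cdots & \mathbf 0 & p_{\sigma_s} \end{bmatrix},$$ and its maximal minors are its $(s+4)\times(s+4)$-minors. A universal Gröbner basis of an ideal is a subset of the ideal that is a Gröbner basis with respect to every term order. *)

theory Defs
  imports
    "HOL-Library.Poly_Mapping"
    "HOL-Library.FuncSet"
    "HOL-Algebra.Ideal"
    "HOL-Computational_Algebra.Polynomial"
    "Jordan_Normal_Form.DL_Rank_Submatrix"
begin

section \<open>The polynomial ring in the unknowns \<open>x\<^sub>i, y\<^sub>i, z\<^sub>i\<close>\<close>

text \<open>
  The pair \<open>(i, c)\<close> with \<open>i < n\<close> and \<open>c < 3\<close> stands for the unknown \<open>x\<^sub>i\<close>, \<open>y\<^sub>i\<close>, \<open>z\<^sub>i\<close>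
  for \<open>c = 0, 1, 2\<close> respectively; the \<open>n\<close> factors are numbered from \<open>0\<close>.  The type \<open>'k mpoly\<close> has
  infinitely many unknowns, so \<open>K[x,y,z]\<close> is cut out of it as a carrier set.
\<close>

type_synonym monom = "nat \<times> nat \<Rightarrow>\<^sub>0 nat"
type_synonym 'k mpoly = "monom \<Rightarrow>\<^sub>0 'k"

definition monoms :: "nat \<Rightarrow> monom set" where
  "monoms n = {t. Poly_Mapping.keys t \<subseteq> {..<n} \<times> {..<3}}"

definition polys :: "nat \<Rightarrow> 'k::zero mpoly set" where
  "polys n = {f. Poly_Mapping.keys f \<subseteq> monoms n}"

definition poly_ring :: "nat \<Rightarrow> 'k::comm_ring_1 mpoly ring" where
  "poly_ring n = \<lparr>carrier = polys n, monoid.mult = (*), one = 1, zero = 0, add = (+)\<rparr>"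

definition Const :: "'k \<Rightarrow> 'k::zero mpoly" where
  "Const a = Poly_Mapping.single 0 a"

definition Var :: "nat \<times> nat \<Rightarrow> 'k::comm_ring_1 mpoly" where
  "Var v = Poly_Mapping.single (Poly_Mapping.single v 1) 1"

definition eval_poly :: "(nat \<times> nat \<Rightarrow> 'k) \<Rightarrow> 'k::comm_ring_1 mpoly \<Rightarrow> 'k" where
  "eval_poly a f = (\<Sum>t\<in>Poly_Mapping.keys f. Poly_Mapping.lookup f t *
     (\<Prod>v\<in>Poly_Mapping.keys t. a v ^ Poly_Mapping.lookup t v))"

text \<open>
  Without this, \<open>genideal (poly_ring n) S\<close> could be an intersection over an empty family of ideals.
\<close>

lemma cring_poly_ring: "cring (poly_ring n :: 'k::comm_ring_1 mpoly ring)"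
proof -
  have monoms_add: "s + t \<in> monoms n" if "s \<in> monoms n" "t \<in> monoms n" for s t
    using that Poly_Mapping.keys_add[of s t] unfolding monoms_def by blast
  have add: "f + g \<in> polys n" if "f \<in> polys n" "g \<in> polys n" for f g :: "'k mpoly"
    using that Poly_Mapping.keys_add[of f g] unfolding polys_def by blast
  have mult: "f * g \<in> polys n" if "f \<in> polys n" "g \<in> polys n" for f g :: "'k mpoly"
    using that Poly_Mapping.keys_mult[of f g] monoms_add unfolding polys_def by blast
  have neg: "- f \<in> polys n" if "f \<in> polys n" for f :: "'k mpoly"
    using that unfolding polys_def by simp
  have zero: "(0 :: 'k mpoly) \<in> polys n" by (simp add: polys_def)
  have one: "(1 :: 'k mpoly) \<in> polys n" by (simp add: polys_def monoms_def)
  show ?thesis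
    by (rule cringI[OF abelian_groupI comm_monoidI])
      (auto simp: poly_ring_def add mult zero one algebra_simps
        intro!: bexI[where x = "- x" for x] neg)
qed


section \<open>Term orders and universal Groebner bases\<close>

definition term_order :: "nat \<Rightarrow> monom rel \<Rightarrow> bool" where
  "term_order n r \<longleftrightarrow>
     linear_order_on (monoms n) r \<and>
     (\<forall>t\<in>monoms n. (0, t) \<in> r) \<and>
     (\<forall>s t. \<forall>u\<in>monoms n. (s, t) \<in> r \<longrightarrow> (s + u, t + u) \<in> r)"

definition initial_monom :: "monom rel \<Rightarrow> 'k::comm_ring_1 mpoly \<Rightarrow> 'k mpoly" where
  "initial_monom r f = Poly_Mapping.single
     (THE t. t \<in> Poly_Mapping.keys f \<and> (\<forall>s\<in>Poly_Mapping.keys f. (s, t) \<in> r)) 1"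

definition initial_ideal :: "nat \<Rightarrow> monom rel \<Rightarrow> 'k::comm_ring_1 mpoly set \<Rightarrow> 'k mpoly set" where
  "initial_ideal n r S = genideal (poly_ring n) (initial_monom r ` (S - {0}))"

definition groebner_basis ::
  "nat \<Rightarrow> monom rel \<Rightarrow> 'k::comm_ring_1 mpoly set \<Rightarrow> 'k mpoly set \<Rightarrow> bool" where
  "groebner_basis n r G I \<longleftrightarrow> G \<subseteq> I \<and> initial_ideal n r G = initial_ideal n r I"

definition universal_groebner_basis ::
  "nat \<Rightarrow> 'k::comm_ring_1 mpoly set \<Rightarrow> 'k mpoly set \<Rightarrow> bool" where
  "universal_groebner_basis n G I \<longleftrightarrow>
     G \<subseteq> I \<and> (\<forall>r. term_order n r \<longrightarrow> groebner_basis n r G I)"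


section \<open>Products of projective planes\<close>

text \<open>A point of projective space is the set of all its homogeneous coordinate vectors.\<close>

definition proj_pt :: "'k::field vec \<Rightarrow> 'k vec set" where
  "proj_pt v = {c \<cdot>\<^sub>v v | c. c \<noteq> 0}"

definition proj_space :: "nat \<Rightarrow> 'k::field vec set set" where
  "proj_space r = proj_pt ` (carrier_vec (r + 1) - {0\<^sub>v (r + 1)})"

definition proj_planes :: "nat \<Rightarrow> (nat \<Rightarrow> 'k::field vec set) set" where
  "proj_planes n = (\<Pi>\<^sub>E i\<in>{..<n}. proj_space 2)"

text \<open>
  An arbitrary polynomial vanishes at a point of \<open>(P\<^sup>2)\<^sup>n\<close> if it vanishes at all choices of
  homogeneous coordinates of that point.
\<close>

definition vanishes_at :: "nat \<Rightarrow> 'k::field mpoly \<Rightarrow> (nat \<Rightarrow> 'k vec set) \<Rightarrow> bool" where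
  "vanishes_at n f P \<longleftrightarrow>
     (\<forall>u. (\<forall>i<n. u i \<in> P i) \<longrightarrow> eval_poly (\<lambda>(i, c). u i $ c) f = 0)"

definition multihomogeneous :: "nat \<Rightarrow> 'k::zero mpoly \<Rightarrow> bool" where
  "multihomogeneous n f \<longleftrightarrow>
     (\<exists>d :: nat \<Rightarrow> nat. \<forall>t\<in>Poly_Mapping.keys f. \<forall>i<n. (\<Sum>c<3. Poly_Mapping.lookup t (i, c)) = d i)"

definition zariski_closed :: "nat \<Rightarrow> (nat \<Rightarrow> 'k::field vec set) set \<Rightarrow> bool" where
  "zariski_closed n Z \<longleftrightarrow>
     (\<exists>S \<subseteq> {f \<in> polys n. multihomogeneous n f}.
        Z = {P \<in> proj_planes n. \<forall>f\<in>S. vanishes_at n f P})"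

definition zariski_closure ::
  "nat \<Rightarrow> (nat \<Rightarrow> 'k::field vec set) set \<Rightarrow> (nat \<Rightarrow> 'k vec set) set" where
  "zariski_closure n X = \<Inter>{Z. zariski_closed n Z \<and> X \<subseteq> Z}"


section \<open>The multiview variety and its ideal\<close>

text \<open>
  The image of the set of coordinate vectors of a point under \<open>A\<^sub>i\<close> is the set of coordinate
  vectors of the image point, unless it is \<open>{0}\<close>.
\<close>

definition multiview_map ::
  "nat \<Rightarrow> (nat \<Rightarrow> 'k::field mat) \<Rightarrow> 'k vec set \<Rightarrow> nat \<Rightarrow> 'k vec set" where
  "multiview_map n A Q = (\<lambda>i\<in>{..<n}. (\<lambda>v. A i *\<^sub>v v) ` Q)"

definition multiview_domain :: "nat \<Rightarrow> (nat \<Rightarrow> 'k::field mat) \<Rightarrow> 'k vec set set" where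
  "multiview_domain n A = {Q \<in> proj_space 3. \<forall>i<n. \<forall>v\<in>Q. A i *\<^sub>v v \<noteq> 0\<^sub>v 3}"

definition multiview_variety ::
  "nat \<Rightarrow> (nat \<Rightarrow> 'k::field mat) \<Rightarrow> (nat \<Rightarrow> 'k vec set) set" where
  "multiview_variety n A = zariski_closure n (multiview_map n A ` multiview_domain n A)"

definition multiview_ideal :: "nat \<Rightarrow> (nat \<Rightarrow> 'k::field mat) \<Rightarrow> 'k mpoly set" where
  "multiview_ideal n A = {f \<in> polys n. \<forall>P\<in>multiview_variety n A. vanishes_at n f P}"


section \<open>Minors, genericity and the matrices \<open>A\<^sub>\<sigma>\<close>\<close>

definition minors :: "nat \<Rightarrow> 'a::comm_ring_1 mat \<Rightarrow> 'a set" where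
  "minors k M = {det (submatrix M I J) | I J.
     I \<subseteq> {..<dim_row M} \<and> card I = k \<and> J \<subseteq> {..<dim_col M} \<and> card J = k}"

definition transposed_cameras :: "nat \<Rightarrow> (nat \<Rightarrow> 'k mat) \<Rightarrow> 'k mat" where
  "transposed_cameras n A = mat 4 (3 * n) (\<lambda>(r, c). transpose_mat (A (c div 3)) $$ (r, c mod 3))"

definition generic :: "nat \<Rightarrow> (nat \<Rightarrow> 'k::field mat) \<Rightarrow> bool" where
  "generic n A \<longleftrightarrow> (\<forall>m\<in>minors 4 (transposed_cameras n A). m \<noteq> 0)"

text \<open>The elements of \<open>\<sigma>\<close> are enumerated in increasing order.\<close>

definition camera_matrix :: "(nat \<Rightarrow> 'k::comm_ring_1 mat) \<Rightarrow> nat set \<Rightarrow> 'k mpoly mat" where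
  "camera_matrix A \<sigma> = mat (3 * card \<sigma>) (card \<sigma> + 4) (\<lambda>(r, c).
     let j = r div 3; k = r mod 3; i = sorted_list_of_set \<sigma> ! j
     in if c < 4 then Const (A i $$ (k, c))
        else if c = 4 + j then Var (i, k) else 0)"

definition maximal_minors :: "(nat \<Rightarrow> 'k::comm_ring_1 mat) \<Rightarrow> nat set \<Rightarrow> 'k mpoly set" where
  "maximal_minors A \<sigma> = minors (card \<sigma> + 4) (camera_matrix A \<sigma>)"

end

theory Submission
  imports Defs
begin

text \<open>
  Fix a term order and rank the three variables of every block by it as \<open>0, 1, 2\<close>; the height of a
  monomial in a block is the largest rank of a variable of the block that occurs in it, and \<open>0\<close> if
  there is none.  A minor of \<open>A\<^sub>\<sigma>\<close> that uses the rows \<open>R\<^sub>i\<close> of the camera \<open>i\<close> is a combination of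
  products of one variable from every \<open>R\<^sub>i\<close>, with coefficients that are, up to sign,
  \<open>4 \<times> 4\<close>-minors of the stacked cameras.  By genericity its leading monomial is therefore the product of the highest
  variables of the \<open>R\<^sub>i\<close>, whatever the term order is.  Hence the monomials of total height at least
  \<open>4\<close> are divisible by such leading monomials, and it remains to see that the monomials
  of total height below \<open>4\<close> and of a given multidegree are linearly independent modulo the
  multiview ideal.  Modulo the ideal they are products of linear forms on \<open>K\<^sup>4\<close> of which any four are
  independent.  Restricting a linear relation to the hyperplane on which the lowest form of a block
  vanishes reduces both the dimension and the total height by one, and a relation all of whose terms
  are divisible by that form can be divided by it.
\<close>

section \<open>Infinite fields and polynomials with too many roots\<close>

text \<open>Over a finite field the product of all \<open>X - a\<close>, plus 1, would have positive
  degree and yet take the value 1 everywhere.\<close>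

lemma infinite_UNIV_alg_closed: "infinite (UNIV :: 'k::alg_closed_field set)"
proof
  assume fin: "finite (UNIV :: 'k set)"
  define p where "p = (\<Prod>a\<in>(UNIV :: 'k set). [:- a, 1:]) + 1"
  have deg: "degree (\<Prod>a\<in>(UNIV :: 'k set). [:- a, 1:]) = card (UNIV :: 'k set)"
    by (subst degree_prod_eq_sum_degree) auto
  have "card (UNIV :: 'k set) > 0"
    using fin by (simp add: card_gt_0_iff)
  then have "degree p > 0"
    unfolding p_def using deg by (subst degree_add_eq_left) auto
  then obtain x where "poly p x = 0"
    using alg_closed_imp_poly_has_root by blast
  moreover have "poly (\<Prod>a\<in>(UNIV :: 'k set). [:- a, 1:]) x = 0"
    using fin by (auto simp: poly_prod)
  ultimately show False
    by (simp add: p_def)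
qed

text \<open>Turns identities valid for almost all parameters into polynomial identities;
  \<open>F\<close> holds the values at which dividing or rescaling is not allowed.\<close>

lemma poly_eq_0_if_infinite_roots:
  fixes p :: "'k::idom poly"
  assumes "infinite (UNIV :: 'k set)" "finite F" "\<And>s. s \<notin> F \<Longrightarrow> poly p s = 0"
  shows "p = 0"
proof (rule ccontr)
  assume "p \<noteq> 0"
  then have "finite {s. poly p s = 0}"
    by (rule poly_roots_finite)
  moreover have "UNIV = F \<union> {s. poly p s = 0}"
    using assms(3) by auto
  ultimately show False
    using assms(1,2) by (metis finite_UnI)
qed


section \<open>Evaluation\<close>

definition monom_val :: "(nat \<times> nat \<Rightarrow> 'k::comm_ring_1) \<Rightarrow> monom \<Rightarrow> 'k" where
  "monom_val a t = (\<Prod>v\<in>Poly_Mapping.keys t. a v ^ Poly_Mapping.lookup t v)"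

lemma monom_val_superset:
  assumes "finite B" "Poly_Mapping.keys t \<subseteq> B"
  shows "monom_val a t = (\<Prod>v\<in>B. a v ^ Poly_Mapping.lookup t v)"
  unfolding monom_val_def
  by (rule prod.mono_neutral_left) (use assms in \<open>auto simp: in_keys_iff\<close>)

lemma monom_val_0 [simp]: "monom_val a 0 = 1"
  by (simp add: monom_val_def)

lemma monom_val_single [simp]: "monom_val a (Poly_Mapping.single v k) = a v ^ k"
  by (simp add: monom_val_def)

lemma monom_val_add: "monom_val a (s + t) = monom_val a s * monom_val a t"
proof -
  let ?B = "Poly_Mapping.keys s \<union> Poly_Mapping.keys t"
  have "Poly_Mapping.keys (s + t) \<subseteq> ?B"
    by (rule Poly_Mapping.keys_add)
  then show ?thesis
    by (simp add: monom_val_superset[of ?B] lookup_add power_add prod.distrib)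
qed

lemma monom_val_sum: "monom_val a (sum t B) = (\<Prod>i\<in>B. monom_val a (t i))"
  by (induction B rule: infinite_finite_induct) (auto simp: monom_val_add)

lemma eval_poly_superset:
  assumes "finite B" "Poly_Mapping.keys f \<subseteq> B"
  shows "eval_poly a f = (\<Sum>t\<in>B. Poly_Mapping.lookup f t * monom_val a t)"
  unfolding eval_poly_def monom_val_def
  by (rule sum.mono_neutral_left) (use assms in \<open>auto simp: in_keys_iff\<close>)

lemma eval_poly_monom_val:
  "eval_poly a f = (\<Sum>t\<in>Poly_Mapping.keys f. Poly_Mapping.lookup f t * monom_val a t)"
  by (rule eval_poly_superset) auto

lemma eval_poly_single [simp]: "eval_poly a (Poly_Mapping.single t c) = c * monom_val a t"
  by (subst eval_poly_superset[of "{t}"]) auto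

lemma eval_poly_0 [simp]: "eval_poly a 0 = 0"
  by (simp add: eval_poly_def)

lemma eval_poly_1 [simp]: "eval_poly a 1 = 1"
  by (simp flip: single_one)

lemma eval_poly_add: "eval_poly a (f + g) = eval_poly a f + eval_poly a g"
proof -
  let ?B = "Poly_Mapping.keys f \<union> Poly_Mapping.keys g"
  have "Poly_Mapping.keys (f + g) \<subseteq> ?B"
    by (rule Poly_Mapping.keys_add)
  then show ?thesis
    by (simp add: eval_poly_superset[of ?B] lookup_add distrib_right sum.distrib)
qed

lemma eval_poly_sum: "eval_poly a (sum f B) = (\<Sum>i\<in>B. eval_poly a (f i))"
  by (induction B rule: infinite_finite_induct) (auto simp: eval_poly_add)

lemma poly_mapping_sum_singles:
  "f = (\<Sum>t\<in>Poly_Mapping.keys f. Poly_Mapping.single t (Poly_Mapping.lookup f t))"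
proof (rule poly_mapping_eqI)
  fix t
  show "Poly_Mapping.lookup f t = Poly_Mapping.lookup
    (\<Sum>t\<in>Poly_Mapping.keys f. Poly_Mapping.single t (Poly_Mapping.lookup f t)) t"
    by (cases "t \<in> Poly_Mapping.keys f")
      (auto simp: lookup_sum lookup_single when_def in_keys_iff)
qed

lemma eval_poly_mult: "eval_poly a (f * g) = eval_poly a f * eval_poly a g"
proof -
  have "f * g = (\<Sum>s\<in>Poly_Mapping.keys f. \<Sum>t\<in>Poly_Mapping.keys g.
      Poly_Mapping.single (s + t) (Poly_Mapping.lookup f s * Poly_Mapping.lookup g t))"
    by (subst (1) poly_mapping_sum_singles[of f], subst (1) poly_mapping_sum_singles[of g])
      (simp add: sum_product mult_single)
  then show ?thesis
    by (simp add: eval_poly_sum monom_val_add eval_poly_monom_val[of a f]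
        eval_poly_monom_val[of a g] sum_product mult_ac)
qed

text \<open>As a ring homomorphism, evaluation commutes with determinants of matrices of
  polynomials.\<close>

interpretation eval_poly: comm_ring_hom "eval_poly a"
  by unfold_locales (simp_all add: eval_poly_add eval_poly_mult)


section \<open>Linear independence of products of linear forms\<close>

text \<open>The component of the multidegree belonging to the factor \<open>i\<close>; the same sum
  occurs in \<open>multihomogeneous\<close>.\<close>

definition block_deg :: "monom \<Rightarrow> nat \<Rightarrow> nat" where
  "block_deg t i = (\<Sum>c<3. Poly_Mapping.lookup t (i, c))"

lemma block_deg_add: "block_deg (s + t) i = block_deg s i + block_deg t i"
  by (simp add: block_deg_def lookup_add sum.distrib)

lemma block_deg_0 [simp]: "block_deg 0 i = 0"
  by (simp add: block_deg_def)

lemma block_deg_single: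
  "c < 3 \<Longrightarrow> block_deg (Poly_Mapping.single (i, c) k) j = (if i = j then k else 0)"
  by (auto simp: block_deg_def lookup_single when_def)

text \<open>The inserted \<open>0\<close> serves monomials without a variable of the block, so
  height 0 also occurs when the variable of rank 0 is the only one of its block.\<close>

definition height :: "(nat \<Rightarrow> nat \<Rightarrow> nat) \<Rightarrow> monom \<Rightarrow> nat \<Rightarrow> nat" where
  "height rk t i = Max (insert 0 (rk i ` {c. c < 3 \<and> Poly_Mapping.lookup t (i, c) \<noteq> 0}))"

lemma height_ge: "c < 3 \<Longrightarrow> Poly_Mapping.lookup t (i, c) \<noteq> 0 \<Longrightarrow> rk i c \<le> height rk t i"
  unfolding height_def by (rule Max_ge) auto

lemma height_le:
  "(\<And>c. c < 3 \<Longrightarrow> Poly_Mapping.lookup t (i, c) \<noteq> 0 \<Longrightarrow> rk i c \<le> m) \<Longrightarrow> height rk t i \<le> m"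
  unfolding height_def by (subst Max_le_iff) auto

lemma height_attained:
  assumes "height rk t i > 0"
  obtains c where "c < 3" "Poly_Mapping.lookup t (i, c) \<noteq> 0" "rk i c = height rk t i"
proof -
  have "height rk t i \<in> insert 0 (rk i ` {c. c < 3 \<and> Poly_Mapping.lookup t (i, c) \<noteq> 0})"
    unfolding height_def by (rule Max_in) auto
  then show thesis
    using assms that by auto
qed

lemma monoms_add: "s \<in> monoms n \<Longrightarrow> t \<in> monoms n \<Longrightarrow> s + t \<in> monoms n"
  using Poly_Mapping.keys_add[of s t] unfolding monoms_def by blast

lemma monoms_sum: "(\<And>i. i \<in> B \<Longrightarrow> t i \<in> monoms n) \<Longrightarrow> sum t B \<in> monoms n"
  by (induction B rule: infinite_finite_induct) (auto simp: monoms_add, auto simp: monoms_def)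

lemma monoms_single: "i < n \<Longrightarrow> c < 3 \<Longrightarrow> Poly_Mapping.single (i, c) k \<in> monoms n"
  by (auto simp: monoms_def)

lemma monoms_eq_0_iff:
  assumes "t \<in> monoms n"
  shows "t = 0 \<longleftrightarrow> (\<forall>i<n. block_deg t i = 0)"
proof
  assume "\<forall>i<n. block_deg t i = 0"
  then have *: "Poly_Mapping.lookup t (i, c) = 0" if "i < n" "c < 3" for i c
    using that unfolding block_deg_def by simp
  have "Poly_Mapping.lookup t v = 0" for v
  proof (cases "v \<in> {..<n} \<times> {..<3}")
    case True
    then show ?thesis
      using * by (cases v) simp
  next
    case False
    then have "v \<notin> Poly_Mapping.keys t"
      using assms unfolding monoms_def by blast
    then show ?thesis
      by (simp add: in_keys_iff)
  qed
  then show "t = 0"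
    by (intro poly_mapping_eqI) simp
qed auto

text \<open>Subtraction of exponents is truncated at 0; the hypothesis is divisibility of
  \<open>t\<close> by \<open>s\<close>, which makes \<open>t - s\<close> the true cofactor.\<close>

lemma monom_divides:
  fixes s t :: monom
  assumes "\<And>v. Poly_Mapping.lookup s v \<le> Poly_Mapping.lookup t v"
  shows "t = s + (t - s)"
  by (rule poly_mapping_eqI) (use assms in \<open>simp add: lookup_add lookup_minus\<close>)

lemma monoms_diff:
  assumes "t \<in> monoms n"
  shows "t - s \<in> monoms n"
proof -
  have "Poly_Mapping.keys (t - s) \<subseteq> Poly_Mapping.keys t"
    by (auto simp: in_keys_iff lookup_minus)
  then show ?thesis
    using assms by (auto simp: monoms_def)
qed

text \<open>Along a line a monomial is a product of linear polynomials in the parameter, so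
  relations on the line can be tested by counting roots.\<close>

lemma monom_val_line:
  "monom_val (\<lambda>v. a v + x * b v) t =
    poly (\<Prod>v\<in>Poly_Mapping.keys t. [:a v, b v:] ^ Poly_Mapping.lookup t v) x"
  by (simp add: monom_val_def poly_prod)

text \<open>
  Pick a block of positive degree and let \<open>b\<close> be its lowest variable.  On the hyperplane \<open>b = 0\<close>
  only the monomials without \<open>b\<close> survive, and there the next variable of the block becomes the
  lowest one; the other monomials are divided by \<open>b\<close>.
\<close>

lemma low_monoms_independent:
  fixes V :: "(nat \<times> nat \<Rightarrow> 'k::field) set" and q :: "nat \<Rightarrow> nat"
  assumes inf: "infinite (UNIV :: 'k set)"
    and zero: "(\<lambda>v. 0) \<in> V"
    and lin: "\<And>a b x. a \<in> V \<Longrightarrow> b \<in> V \<Longrightarrow> (\<lambda>v. a v + x * b v) \<in> V"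
    and dual: "\<And>J j. J \<subseteq> {..<n} \<times> {..<3} \<Longrightarrow> card J \<le> 4 \<Longrightarrow> j \<in> J \<Longrightarrow>
      \<exists>a\<in>V. a j = 1 \<and> (\<forall>j'\<in>J - {j}. a j' = 0)"
    and rk: "\<And>i. i < n \<Longrightarrow> bij_betw (rk i) {..<3} {..<3}"
    and "finite T" "T \<subseteq> monoms n"
    and "\<And>t i. t \<in> T \<Longrightarrow> i < n \<Longrightarrow> block_deg t i = u i"
    and "\<And>t i c. t \<in> T \<Longrightarrow> i < n \<Longrightarrow> c < 3 \<Longrightarrow> rk i c < q i \<Longrightarrow> Poly_Mapping.lookup t (i, c) = 0"
    and "\<And>t. t \<in> T \<Longrightarrow> (\<Sum>i<n. max (q i) (height rk t i)) < 4"
    and "\<And>a. a \<in> V \<Longrightarrow> (\<And>i c. i < n \<Longrightarrow> c < 3 \<Longrightarrow> rk i c < q i \<Longrightarrow> a (i, c) = 0) \<Longrightarrow>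
      (\<Sum>t\<in>T. d t * monom_val a t) = 0"
    and "t \<in> T"
  shows "d t = 0"
  using assms(6-)
\<comment> \<open>\<open>q i\<close> counts the lowest variables of block \<open>i\<close> already
  set to zero, and \<open>u\<close> is the multidegree. Restricting to a hyperplane raises the sum
  of \<open>q\<close>, division lowers the sum of \<open>u\<close>.\<close>
proof (induction "(4 - (\<Sum>i<n. q i)) + (\<Sum>i<n. u i)" arbitrary: q u T d t rule: less_induct)
  case less
  note fin = less.prems(1) and mon = less.prems(2) and deg = less.prems(3) and low = less.prems(4)
    and ht = less.prems(5) and van = less.prems(6) and tT = less.prems(7)
  show ?case
  proof (cases "\<exists>i<n. u i > 0")
    case False
    then have "s = 0" if "s \<in> T" for s
      using that deg mon monoms_eq_0_iff[of s n] by auto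
    then have "T = {0}" "t = 0"
      using tT by auto
    \<comment> \<open>Only the constant monomial is left, and the zero point of \<open>V\<close>
      isolates its coefficient.\<close>
    then show ?thesis
      using van[OF zero] by simp
  next
    case True
    then obtain i where i: "i < n" "u i > 0"
      by blast
    have supp: "\<exists>c<3. Poly_Mapping.lookup s (i, c) \<noteq> 0 \<and> q i \<le> rk i c" if "s \<in> T" for s
    proof -
      have "(\<Sum>c<3. Poly_Mapping.lookup s (i, c)) \<noteq> 0"
        using deg[OF that i(1)] i(2) by (simp add: block_deg_def)
      then obtain c where "c < 3" "Poly_Mapping.lookup s (i, c) \<noteq> 0"
        by (metis lessThan_iff sum.neutral)
      then show ?thesis
        using low[OF that i(1)] by (meson not_le)
    qed
    obtain c0 where "c0 < 3" "q i \<le> rk i c0"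
      using supp[OF tT] by blast
    moreover from this have "rk i c0 < 3"
      using bij_betwE[OF rk[OF i(1)]] by auto
    ultimately have "q i < 3"
      by linarith
    \<comment> \<open>The lowest variable of block \<open>i\<close> not yet set to zero.\<close>
    then obtain b where b: "b < 3" "rk i b = q i"
      using rk[OF i(1)] unfolding bij_betw_def by (metis imageE lessThan_iff)
    have rk_b: "c = b" if "c < 3" "rk i c = q i" for c
      using that b rk[OF i(1)] by (auto simp: bij_betw_def inj_on_def)
    let ?q = "q(i := Suc (q i))"
    define T0 where "T0 = {s \<in> T. Poly_Mapping.lookup s (i, b) = 0}"
    have dT0: "d s = 0" if "s \<in> T0" for s
    proof (rule less.hyps[of ?q u T0 d])
      \<comment> \<open>A monomial of positive degree in block \<open>i\<close> and free of
        \<open>b\<close> contains a variable of rank above \<open>q i\<close>. Hence raising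
        \<open>q i\<close> by one does not disturb the bound on the total height.\<close>
      have max_eq: "max (?q j) (height rk s j) = max (q j) (height rk s j)" if "s \<in> T0" for s j
      proof -
        obtain c where "c < 3" "Poly_Mapping.lookup s (i, c) \<noteq> 0" "q i \<le> rk i c"
          using supp[of s] \<open>s \<in> T0\<close> by (auto simp: T0_def)
        moreover from this have "rk i c \<noteq> q i"
          using rk_b[of c] \<open>s \<in> T0\<close> by (auto simp: T0_def)
        ultimately have "q i < height rk s i"
          using height_ge[of c s i rk] by linarith
        then show ?thesis
          by (cases "j = i") auto
      qed
      show ht0: "(\<Sum>j<n. max (?q j) (height rk s j)) < 4" if "s \<in> T0" for s
        using ht[of s] that by (simp only: max_eq) (simp add: T0_def)
      have "(\<Sum>j<n. ?q j) = Suc (\<Sum>j<n. q j)"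
        using i(1) by (simp add: sum.remove[of "{..<n}" i])
      \<comment> \<open>Staying below 4 makes the truncated difference in the measure drop
        strictly.\<close>
      moreover have "(\<Sum>j<n. ?q j) < 4"
        by (rule le_less_trans[OF sum_mono ht0[OF that]]) simp
      ultimately show "4 - (\<Sum>j<n. ?q j) + (\<Sum>j<n. u j) < 4 - (\<Sum>j<n. q j) + (\<Sum>j<n. u j)"
        by linarith
      show "finite T0" "T0 \<subseteq> monoms n" "s \<in> T0"
        using fin mon that by (auto simp: T0_def)
      show "block_deg s j = u j" if "s \<in> T0" "j < n" for s j
        using that deg by (auto simp: T0_def)
      show "Poly_Mapping.lookup s (j, c) = 0"
        if "s \<in> T0" "j < n" "c < 3" "rk j c < ?q j" for s j c
        using that low[of s j c] rk_b[of c]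
        by (auto simp: T0_def less_Suc_eq split: if_splits)
      fix a assume a: "a \<in> V" "\<And>j c. j < n \<Longrightarrow> c < 3 \<Longrightarrow> rk j c < ?q j \<Longrightarrow> a (j, c) = 0"
      have "a (i, b) = 0"
        using a(2)[of i b] b i(1) by simp
      then have "monom_val a s = 0" if "s \<in> T - T0" for s
        using that by (auto simp: T0_def monom_val_def in_keys_iff intro!: bexI[of _ "(i, b)"])
      then have "(\<Sum>s\<in>T0. d s * monom_val a s) = (\<Sum>s\<in>T. d s * monom_val a s)"
        using fin by (intro sum.mono_neutral_left) (auto simp: T0_def)
      also have "\<dots> = 0"
        using a(2) by (intro van a(1)) (metis fun_upd_apply less_Suc_eq)
      finally show "(\<Sum>s\<in>T0. d s * monom_val a s) = 0" .
    qed
    define T1 where "T1 = T - T0"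
    let ?e = "Poly_Mapping.single (i, b) (1 :: nat)"
    have split: "s = ?e + (s - ?e)" if "s \<in> T1" for s
      by (rule monom_divides) (use that in \<open>auto simp: T1_def T0_def lookup_single when_def\<close>)
    have inj: "inj_on (\<lambda>s. s - ?e) T1"
      by (rule inj_onI) (metis split)
    show ?thesis
    proof (cases "t \<in> T0")
      case False
      then have t1: "t \<in> T1"
        using tT by (simp add: T1_def)
      \<comment> \<open>The coefficients of the monomials containing \<open>b\<close>, reindexed by
        their quotients by \<open>b\<close>.\<close>
      define d' where "d' s = d (?e + s)" for s
      let ?u = "u(i := u i - 1)" and ?T = "(\<lambda>s. s - ?e) ` T1"
      have T1D: "\<exists>r\<in>T. r = ?e + s" if "s \<in> ?T" for s
        using that split by (auto simp: T1_def)
      have "d' (t - ?e) = 0"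
      proof (rule less.hyps[of q ?u ?T d'])
        have "(\<Sum>j<n. u j) = Suc (\<Sum>j<n. ?u j)"
          using i by (simp add: sum.remove[of "{..<n}" i])
        then show "4 - (\<Sum>j<n. q j) + (\<Sum>j<n. ?u j) < 4 - (\<Sum>j<n. q j) + (\<Sum>j<n. u j)"
          by simp
        show "finite ?T" "?T \<subseteq> monoms n" "t - ?e \<in> ?T"
          using fin mon t1 by (auto simp: T1_def intro!: monoms_diff)
        show "block_deg s j = ?u j" if "s \<in> ?T" "j < n" for s j
        proof -
          obtain r where "r \<in> T" "r = ?e + s"
            using T1D[OF \<open>s \<in> ?T\<close>] by blast
          then have "u j = block_deg ?e j + block_deg s j"
            using deg[OF _ \<open>j < n\<close>] by (metis block_deg_add)
          then show ?thesis
            using b(1) by (auto simp: block_deg_single split: if_splits)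
        qed
        show "Poly_Mapping.lookup s (j, c) = 0"
          if "s \<in> ?T" "j < n" "c < 3" "rk j c < q j" for s j c
        proof -
          obtain r where r: "r \<in> T" "r = ?e + s"
            using T1D[OF \<open>s \<in> ?T\<close>] by blast
          then show ?thesis
            using low[OF r(1) \<open>j < n\<close> \<open>c < 3\<close> \<open>rk j c < q j\<close>] by (simp add: lookup_add)
        qed
        show "(\<Sum>j<n. max (q j) (height rk s j)) < 4" if "s \<in> ?T" for s
        proof -
          obtain r where r: "r \<in> T" "r = ?e + s"
            using T1D[OF \<open>s \<in> ?T\<close>] by blast
          then have "height rk s j \<le> height rk r j" for j
            by (intro height_le height_ge) (auto simp: lookup_add)
          then show ?thesis
            by (intro le_less_trans[OF sum_mono ht[OF r(1)]]) (simp add: max.coboundedI2)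
        qed
        fix a assume a: "a \<in> V" "\<And>j c. j < n \<Longrightarrow> c < 3 \<Longrightarrow> rk j c < q j \<Longrightarrow> a (j, c) = 0"
        \<comment> \<open>The variables already forced to vanish. Together with
          \<open>(i, b)\<close> there are at most four of them, so \<open>dual\<close> gives a
          direction \<open>w\<close> inside the current subspace along which \<open>b\<close>
          varies.\<close>
        define J where "J = {(j, c). j < n \<and> c < 3 \<and> rk j c < q j}"
        have J_Sigma: "J = Sigma {..<n} (\<lambda>j. {c \<in> {..<3}. rk j c < q j})"
          by (auto simp: J_def)
        have "card {c \<in> {..<3}. rk j c < q j} \<le> q j" if "j < n" for j
        proof -
          have "card {c \<in> {..<3}. rk j c < q j} = card (rk j ` {c \<in> {..<3}. rk j c < q j})"
            using rk[OF that] by (intro card_image[symmetric]) (auto simp: bij_betw_def inj_on_def)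
          also have "\<dots> \<le> card {..<q j}"
            by (rule card_mono) auto
          finally show ?thesis
            by simp
        qed
        then have "card J \<le> (\<Sum>j<n. q j)"
          unfolding J_Sigma by (subst card_SigmaI) (auto intro!: sum_mono)
        moreover have "(\<Sum>j<n. q j) < 4"
          by (rule le_less_trans[OF sum_mono ht[OF tT]]) simp
        moreover have "finite J"
          unfolding J_Sigma by auto
        ultimately have "card (insert (i, b) J) \<le> 4"
          by (simp add: card_insert_if)
        moreover have "insert (i, b) J \<subseteq> {..<n} \<times> {..<3}"
          using i b by (auto simp: J_def)
        ultimately obtain w where w: "w \<in> V" "w (i, b) = 1" "\<forall>j\<in>insert (i, b) J - {(i, b)}. w j = 0"
          using dual[of "insert (i, b) J" "(i, b)"] by blast
        have w0: "w (j, c) = 0" if "j < n" "c < 3" "rk j c < q j" for j c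
          using w(3) that b by (auto simp: J_def)
        let ?l = "\<lambda>x v. a v + x * w v"
        \<comment> \<open>Division by \<open>b\<close> is allowed only where \<open>b\<close> is
          nonzero. On the line through \<open>a\<close> in direction \<open>w\<close> this excludes
          the single parameter \<open>- a (i, b)\<close>, so the divided relation holds identically
          in \<open>x\<close>, in particular at \<open>x = 0\<close>, the point \<open>a\<close>
          itself.\<close>
        define p where "p = (\<Sum>s\<in>?T. [:d' s:] *
          (\<Prod>v\<in>Poly_Mapping.keys s. [:a v, w v:] ^ Poly_Mapping.lookup s v))"
        have p: "poly p x = (\<Sum>s\<in>?T. d' s * monom_val (?l x) s)" for x
          by (simp add: p_def poly_sum monom_val_line)
        have "poly p x = 0" if "x \<notin> {- a (i, b)}" for x
        proof -
          have "0 = (\<Sum>s\<in>T. d s * monom_val (?l x) s)"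
            using a w0 by (intro van[symmetric] lin w(1)) auto
          also have "\<dots> = (\<Sum>s\<in>T1. d s * monom_val (?l x) s)"
            using fin dT0 by (intro sum.mono_neutral_right) (auto simp: T1_def)
          also have "\<dots> = (\<Sum>s\<in>T1. ?l x (i, b) * (d' (s - ?e) * monom_val (?l x) (s - ?e)))"
          proof (rule sum.cong[OF refl])
            fix s assume "s \<in> T1"
            note eq = split[OF this]
            have "monom_val (?l x) s = ?l x (i, b) * monom_val (?l x) (s - ?e)"
              by (subst eq) (simp add: monom_val_add)
            moreover have "d s = d' (s - ?e)"
              unfolding d'_def by (rule arg_cong[OF eq])
            ultimately show "d s * monom_val (?l x) s =
                ?l x (i, b) * (d' (s - ?e) * monom_val (?l x) (s - ?e))"
              by simp
          qed
          also have "\<dots> = ?l x (i, b) * poly p x"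
            unfolding p by (subst sum.reindex[OF inj]) (simp add: sum_distrib_left)
          finally show ?thesis
            using that w(2) by (auto simp: add_eq_0_iff)
        qed
        then have "p = 0"
          by (intro poly_eq_0_if_infinite_roots[OF inf, of "{- a (i, b)}"]) auto
        then show "(\<Sum>s\<in>?T. d' s * monom_val a s) = 0"
          using p[of 0] by simp
      qed
      then show ?thesis
        using split[OF t1] by (simp add: d'_def)
    qed (rule dT0)
  qed
qed

lemma block_deg_sum: "block_deg (sum t B) i = (\<Sum>j\<in>B. block_deg (t j) i)"
  by (induction B rule: infinite_finite_induct) (simp_all add: block_deg_add)

lemma lookup_sum_single:
  assumes "finite B"
  shows "Poly_Mapping.lookup (\<Sum>i\<in>B. Poly_Mapping.single (i, c i) (1 :: nat)) (j, k) =
    (if j \<in> B \<and> k = c j then 1 else 0)"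
proof -
  have "Poly_Mapping.lookup (\<Sum>i\<in>B. Poly_Mapping.single (i, c i) (1 :: nat)) (j, k) =
      (\<Sum>i\<in>B. if i = j then (if k = c j then 1 else 0) else 0)"
    unfolding lookup_sum by (rule sum.cong) (auto simp: lookup_single when_def)
  then show ?thesis
    using assms by simp
qed

text \<open>
  Multiplying by the lowest variable of every block does not change the heights, and makes every
  polynomial identity trivial at the points at which one of the blocks vanishes.
\<close>

lemma low_monoms_independent_nonzero_blocks:
  fixes V :: "(nat \<times> nat \<Rightarrow> 'k::field) set"
  assumes inf: "infinite (UNIV :: 'k set)"
    and zero: "(\<lambda>v. 0) \<in> V"
    and lin: "\<And>a b x. a \<in> V \<Longrightarrow> b \<in> V \<Longrightarrow> (\<lambda>v. a v + x * b v) \<in> V"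
    and dual: "\<And>J j. J \<subseteq> {..<n} \<times> {..<3} \<Longrightarrow> card J \<le> 4 \<Longrightarrow> j \<in> J \<Longrightarrow>
      \<exists>a\<in>V. a j = 1 \<and> (\<forall>j'\<in>J - {j}. a j' = 0)"
    and rk: "\<And>i. i < n \<Longrightarrow> bij_betw (rk i) {..<3} {..<3}"
    and fin: "finite T" and mon: "T \<subseteq> monoms n"
    and deg: "\<And>t i. t \<in> T \<Longrightarrow> i < n \<Longrightarrow> block_deg t i = u i"
    and ht: "\<And>t. t \<in> T \<Longrightarrow> (\<Sum>i<n. height rk t i) < 4"
    and van: "\<And>a. a \<in> V \<Longrightarrow> (\<And>i. i < n \<Longrightarrow> \<exists>c<3. a (i, c) \<noteq> 0) \<Longrightarrow>
      (\<Sum>t\<in>T. d t * monom_val a t) = 0"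
    and t: "t \<in> T"
  shows "d t = 0"
proof -
  have "\<exists>c<3. rk i c = 0" if "i < n" for i
    using rk[OF that] unfolding bij_betw_def by (metis imageE lessThan_iff zero_less_numeral)
  then obtain b where b: "\<And>i. i < n \<Longrightarrow> b i < 3 \<and> rk i (b i) = 0"
    by metis
  define e where "e = (\<Sum>i<n. Poly_Mapping.single (i, b i) (1 :: nat))"
  have lookup_e: "Poly_Mapping.lookup e (i, c) = (if i < n \<and> c = b i then 1 else 0)" for i c
    unfolding e_def by (subst lookup_sum_single) auto
  \<comment> \<open>The previous result is applied to the products \<open>e + s\<close>, with no
    variable set to zero yet; subtracting \<open>e\<close> recovers the original
    coefficient.\<close>
  have "(\<lambda>s. d (s - e)) (e + t) = 0"
  proof (rule low_monoms_independent[where V = V and n = n and rk = rk and T = "(\<lambda>s. e + s) ` T"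
        and q = "\<lambda>i. 0" and u = "\<lambda>i. Suc (u i)" and d = "\<lambda>s. d (s - e)" and t = "e + t"],
      fact inf, fact zero)
    show "bij_betw (rk i) {..<3} {..<3}" if "i < n" for i
      by (rule rk[OF that])
    show "finite ((\<lambda>s. e + s) ` T)" "e + t \<in> (\<lambda>s. e + s) ` T"
      using fin t by auto
    have "e \<in> monoms n"
      unfolding e_def by (rule monoms_sum) (use b in \<open>auto intro: monoms_single\<close>)
    then show "(\<lambda>s. e + s) ` T \<subseteq> monoms n"
      using mon by (auto intro: monoms_add)
    have "block_deg e i = 1" if "i < n" for i
    proof -
      have "(\<Sum>c<3. Poly_Mapping.lookup e (i, c)) = (\<Sum>c<3. if c = b i then 1 else 0)"
        using that by (simp add: lookup_e)
      then show ?thesis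
        using b[OF that] by (simp add: block_deg_def)
    qed
    then show "block_deg s i = Suc (u i)" if "s \<in> (\<lambda>s. e + s) ` T" "i < n" for s i
      using that deg by (auto simp: block_deg_add)
    show "(\<Sum>i<n. max 0 (height rk s i)) < 4" if "s \<in> (\<lambda>s. e + s) ` T" for s
    proof -
      obtain r where r: "r \<in> T" "s = e + r"
        using \<open>s \<in> _\<close> by blast
      have "height rk s i \<le> height rk r i" if "i < n" for i
      proof (rule height_le)
        fix c assume c: "c < 3" "Poly_Mapping.lookup s (i, c) \<noteq> 0"
        show "rk i c \<le> height rk r i"
        proof (cases "c = b i")
          case True
          then show ?thesis
            using b[OF that] by simp
        next
          case False
          then show ?thesis
            using c r(2) by (intro height_ge) (auto simp: lookup_add lookup_e)
        qed
      qed
      then have "(\<Sum>i<n. height rk s i) \<le> (\<Sum>i<n. height rk r i)"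
        by (intro sum_mono) auto
      then show ?thesis
        using ht[OF r(1)] by simp
    qed
    fix a assume a: "a \<in> V"
    have "(\<Sum>s\<in>(\<lambda>s. e + s) ` T. d (s - e) * monom_val a s) =
        (\<Sum>s\<in>T. d s * (monom_val a e * monom_val a s))"
      by (subst sum.reindex) (auto simp: monom_val_add)
    also have "\<dots> = monom_val a e * (\<Sum>s\<in>T. d s * monom_val a s)"
      by (simp add: sum_distrib_left mult_ac)
    also have "\<dots> = 0"
    \<comment> \<open>If all lowest variables are nonzero at \<open>a\<close>, no block of
      \<open>a\<close> vanishes and \<open>van\<close> applies; otherwise the factor
      \<open>e\<close> vanishes.\<close>
    proof (cases "\<forall>i<n. a (i, b i) \<noteq> 0")
      case True
      then have "\<exists>c<3. a (i, c) \<noteq> 0" if "i < n" for i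
        by (intro exI[of _ "b i"]) (use True b[OF that] that in simp)
      then show ?thesis
        by (simp add: van[OF a])
    next
      case False
      then have "monom_val a e = 0"
        by (auto simp: e_def monom_val_sum)
      then show ?thesis
        by simp
    qed
    finally show "(\<Sum>s\<in>(\<lambda>s. e + s) ` T. d (s - e) * monom_val a s) = 0" .
  qed (use lin dual in auto)
  then show ?thesis
    by simp
qed


section \<open>Term orders\<close>

lemma term_orderD:
  assumes "term_order n r"
  shows term_order_trans: "(s, t) \<in> r \<Longrightarrow> (t, u) \<in> r \<Longrightarrow> (s, u) \<in> r"
    and term_order_antisym: "(s, t) \<in> r \<Longrightarrow> (t, s) \<in> r \<Longrightarrow> s = t"
    and term_order_linear: "s \<in> monoms n \<Longrightarrow> t \<in> monoms n \<Longrightarrow> (s, t) \<in> r \<or> (t, s) \<in> r"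
    and term_order_refl: "s \<in> monoms n \<Longrightarrow> (s, s) \<in> r"
    and term_order_add: "(s, t) \<in> r \<Longrightarrow> u \<in> monoms n \<Longrightarrow> (s + u, t + u) \<in> r"
  using assms unfolding term_order_def linear_order_on_def partial_order_on_def preorder_on_def
    trans_def antisym_def total_on_def refl_on_def by metis+

text \<open>The summands are exchanged one at a time by compatibility with addition, and
  transitivity joins the exchanges.\<close>

lemma term_order_sum:
  assumes r: "term_order n r" and "finite B"
    and "\<And>i. i \<in> B \<Longrightarrow> s i \<in> monoms n" "\<And>i. i \<in> B \<Longrightarrow> t i \<in> monoms n"
    and "\<And>i. i \<in> B \<Longrightarrow> (s i, t i) \<in> r"
  shows "(sum s B, sum t B) \<in> r"
  using assms(2-)
proof (induction B rule: finite_induct)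
  case empty
  then show ?case
    using r by (simp add: monoms_def term_order_refl)
next
  case (insert i B)
  have "(s i + sum s B, t i + sum s B) \<in> r"
    using insert by (intro term_order_add[OF r] monoms_sum) auto
  moreover have "(t i + sum s B, t i + sum t B) \<in> r"
    unfolding add.commute[of "t i"] using insert by (intro term_order_add[OF r]) auto
  ultimately have "(s i + sum s B, t i + sum t B) \<in> r"
    by (rule term_order_trans[OF r])
  then show ?case
    using insert by simp
qed

text \<open>Supplies the leading monomial of a nonzero polynomial.\<close>

lemma term_order_max:
  assumes r: "term_order n r" and "finite B" "B \<noteq> {}" "B \<subseteq> monoms n"
  shows "\<exists>t\<in>B. \<forall>s\<in>B. (s, t) \<in> r"
  using assms(2-)
proof (induction B rule: finite_ne_induct)
  case (singleton t)
  then show ?case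
    using r by (simp add: term_order_refl)
next
  case (insert t B)
  then obtain m where m: "m \<in> B" "\<forall>s\<in>B. (s, m) \<in> r"
    by auto
  have "(t, m) \<in> r \<or> (m, t) \<in> r"
    using insert.prems m(1) by (intro term_order_linear[OF r]) auto
  then show ?case
  proof
    assume "(t, m) \<in> r"
    then show ?thesis
      using m by (intro bexI[of _ m]) auto
  next
    assume mt: "(m, t) \<in> r"
    then have "(s, t) \<in> r" if "s \<in> B" for s
      using m(2) that term_order_trans[OF r, of s m t] by blast
    then show ?thesis
      using insert.prems term_order_refl[OF r, of t] by (intro bexI[of _ t]) auto
  qed
qed

text \<open>Antisymmetry makes the greatest monomial unique, which resolves the definite description
  in \<open>initial_monom\<close>.\<close>

lemma initial_monomI:
  assumes "term_order n r" "t \<in> Poly_Mapping.keys f" "\<And>s. s \<in> Poly_Mapping.keys f \<Longrightarrow> (s, t) \<in> r"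
  shows "initial_monom r f = Poly_Mapping.single t 1"
proof -
  have "(THE t. t \<in> Poly_Mapping.keys f \<and> (\<forall>s\<in>Poly_Mapping.keys f. (s, t) \<in> r)) = t"
    using assms by (intro the_equality) (auto intro: term_order_antisym)
  then show ?thesis
    by (simp add: initial_monom_def)
qed

text \<open>Counting the other variables of the block that lie below makes the ranks start at
  0.\<close>

definition var_rank :: "monom rel \<Rightarrow> nat \<Rightarrow> nat \<Rightarrow> nat" where
  "var_rank r i c = card {c'. c' < 3 \<and> c' \<noteq> c \<and>
     (Poly_Mapping.single (i, c') 1, Poly_Mapping.single (i, c) 1) \<in> r}"

text \<open>By transitivity and antisymmetry every variable counted for \<open>c\<close> is counted
  for \<open>d\<close>, and \<open>c\<close> itself is counted for \<open>d\<close> only.\<close>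

lemma var_rank_less:
  assumes r: "term_order n r" and "i < n" "c < 3" "d < 3" "c \<noteq> d"
    and cd: "(Poly_Mapping.single (i, c) 1, Poly_Mapping.single (i, d) 1) \<in> r"
  shows "var_rank r i c < var_rank r i d"
  unfolding var_rank_def
proof (rule psubset_card_mono)
  let ?e = "\<lambda>c. Poly_Mapping.single (i, c) (1 :: nat)"
  have "?e c \<noteq> ?e d"
    using assms(5) by (metis lookup_single_eq lookup_single_not_eq prod.inject zero_neq_one)
  then have "(?e d, ?e c) \<notin> r"
    using cd term_order_antisym[OF r] by blast
  then show "{c'. c' < 3 \<and> c' \<noteq> c \<and> (?e c', ?e c) \<in> r} \<subset> {c'. c' < 3 \<and> c' \<noteq> d \<and> (?e c', ?e d) \<in> r}"
    using cd assms(3,5) term_order_trans[OF r] by blast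
qed simp

lemma var_rank_le_imp:
  assumes r: "term_order n r" and "i < n" "c < 3" "d < 3" "var_rank r i c \<le> var_rank r i d"
  shows "(Poly_Mapping.single (i, c) 1, Poly_Mapping.single (i, d) 1) \<in> r"
proof (cases "c = d")
  case True
  then show ?thesis
    using assms by (simp add: term_order_refl[OF r] monoms_single)
next
  case False
  then show ?thesis
    using assms var_rank_less[OF r, of i d c] term_order_linear[OF r] monoms_single
    by (metis not_le)
qed

lemma bij_betw_var_rank:
  assumes r: "term_order n r" and i: "i < n"
  shows "bij_betw (var_rank r i) {..<3} {..<3}"
proof -
  have "var_rank r i c < 3" if "c < 3" for c
  proof -
    have "var_rank r i c \<le> card ({..<3} - {c})"
      unfolding var_rank_def by (rule card_mono) auto
    then show ?thesis
      using that by simp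
  qed
  moreover have "inj_on (var_rank r i) {..<3}"
  proof (rule inj_onI, rule ccontr)
    fix c d assume cd: "c \<in> {..<3}" "d \<in> {..<3}" "var_rank r i c = var_rank r i d" "c \<noteq> d"
    then have "var_rank r i c < var_rank r i d"
      by (intro var_rank_less[OF r i] var_rank_le_imp[OF r i]) auto
    then show False
      using cd by simp
  qed
  ultimately show ?thesis
    unfolding bij_betw_def by (intro conjI endo_inj_surj) auto
qed


section \<open>Leading monomials of polynomials vanishing on a linear space\<close>

definition monoms_of_deg :: "nat \<Rightarrow> (nat \<Rightarrow> nat) \<Rightarrow> monom set" where
  "monoms_of_deg n u = {t \<in> monoms n. \<forall>i<n. block_deg t i = u i}"

text \<open>The exponents are bounded by the total degree and vanish outside the \<open>3n\<close>
  unknowns.\<close>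

lemma finite_monoms_of_deg: "finite (monoms_of_deg n u)"
proof -
  let ?F = "{f. \<forall>v. (v \<in> {..<n} \<times> {..<3::nat} \<longrightarrow> f v \<in> {..(\<Sum>i<n. u i)}) \<and>
    (v \<notin> {..<n} \<times> {..<3} \<longrightarrow> f v = 0)}"
  have bound: "Poly_Mapping.lookup t v \<le> (\<Sum>i<n. u i)"
    if t: "t \<in> monoms_of_deg n u" and "v \<in> {..<n} \<times> {..<3}" for t v
  proof -
    obtain i c where v: "v = (i, c)" "i < n" "c < 3"
      using \<open>v \<in> _\<close> by auto
    have "Poly_Mapping.lookup t v \<le> block_deg t i"
      unfolding block_deg_def v(1) by (rule member_le_sum) (use v in auto)
    also have "\<dots> \<le> (\<Sum>i<n. u i)"
      using t v(2) by (auto simp: monoms_of_deg_def intro!: member_le_sum)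
    finally show ?thesis .
  qed
  have outside: "Poly_Mapping.lookup t v = 0"
    if "t \<in> monoms_of_deg n u" "v \<notin> {..<n} \<times> {..<3}" for t v
  proof -
    have "Poly_Mapping.keys t \<subseteq> {..<n} \<times> {..<3}"
      using that by (simp add: monoms_of_deg_def monoms_def)
    then have "v \<notin> Poly_Mapping.keys t"
      using \<open>v \<notin> _\<close> by (rule contra_subsetD)
    then show ?thesis
      by (simp add: in_keys_iff)
  qed
  have "Poly_Mapping.lookup ` monoms_of_deg n u \<subseteq> ?F"
    by (intro image_subsetI CollectI allI conjI impI) (simp only: atMost_iff bound, rule outside)
  moreover have "finite ?F"
    by (rule finite_set_of_finite_funs) auto
  ultimately have "finite (Poly_Mapping.lookup ` monoms_of_deg n u)"
    by (rule finite_subset)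
  moreover have "inj_on Poly_Mapping.lookup (monoms_of_deg n u)"
    by (intro inj_onI) (simp only: poly_mapping_eq_iff)
  ultimately show ?thesis
    by (rule finite_imageD)
qed

text \<open>
  The functions \<open>monom_val\<close> on \<open>V\<close> are rewritten by the relations to combinations of
  smaller low monomials; no Noetherianity is needed as there are finitely many monomials of a
  given multidegree.
\<close>

lemma normal_form:
  fixes V :: "(nat \<times> nat \<Rightarrow> 'k::field) set"
  assumes r: "term_order n r"
    and rel: "\<And>t. t \<in> monoms n \<Longrightarrow> \<not> low t \<Longrightarrow>
      \<exists>m s t'. s \<in> Poly_Mapping.keys m \<and> t = s + t' \<and> t' \<in> monoms n \<and>
        (\<forall>s'\<in>Poly_Mapping.keys m. (s', s) \<in> r \<and> s' \<in> monoms n \<and> (\<forall>i<n. block_deg s' i = block_deg s i)) \<and>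
        (\<forall>a\<in>V. eval_poly a m = 0)"
    and t: "t \<in> monoms_of_deg n u"
  shows "\<exists>d. (\<forall>s\<in>monoms_of_deg n u. d s \<noteq> 0 \<longrightarrow> low s \<and> (s, t) \<in> r) \<and> (low t \<longrightarrow> d t = 1) \<and>
    (\<forall>a\<in>V. monom_val a t = (\<Sum>s\<in>monoms_of_deg n u. d s * monom_val a s))"
  using t
\<comment> \<open>The measure counts the monomials of the same multidegree that are at most
  \<open>t\<close>; rewriting stays inside this finite set.\<close>
proof (induction t rule: measure_induct_rule[where f = "\<lambda>t. card {s \<in> monoms_of_deg n u. (s, t) \<in> r}"])
  case (less t)
  let ?M = "monoms_of_deg n u"
  have tM: "t \<in> monoms n"
    using less.prems by (simp add: monoms_of_deg_def)
  show ?case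
  proof (cases "low t")
    case True
    have "(\<Sum>s\<in>?M. (if s = t then 1 else 0) * monom_val a s) = monom_val a t" for a :: "nat \<times> nat \<Rightarrow> 'k"
      using less.prems finite_monoms_of_deg[of n u] by (simp add: if_distrib[of "\<lambda>x. x * _"] cong: if_cong)
    then show ?thesis
      using True term_order_refl[OF r tM] by (intro exI[of _ "\<lambda>s. if s = t then 1 else 0"]) auto
  next
    case False
    from rel[OF tM False] obtain m s t' where m: "s \<in> Poly_Mapping.keys m" "t = s + t'" "t' \<in> monoms n"
      "\<forall>s'\<in>Poly_Mapping.keys m. (s', s) \<in> r \<and> s' \<in> monoms n \<and> (\<forall>i<n. block_deg s' i = block_deg s i)"
      "\<forall>a\<in>V. eval_poly a m = 0"
      by (elim exE conjE) (rule that)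
    define K where "K = Poly_Mapping.keys m - {s}"
    let ?P = "\<lambda>s' d. (\<forall>x\<in>?M. d x \<noteq> 0 \<longrightarrow> low x \<and> (x, t) \<in> r) \<and>
      (\<forall>a\<in>V. monom_val a (s' + t') = (\<Sum>x\<in>?M. d x * monom_val a x))"
    \<comment> \<open>Each other term of the relation, multiplied by the cofactor \<open>t'\<close>,
      has the multidegree of \<open>t\<close> and is strictly smaller, so the induction hypothesis
      applies.\<close>
    have "\<exists>d. ?P s' d" if "s' \<in> K" for s'
    proof -
      have s': "s' \<in> Poly_Mapping.keys m" "s' \<noteq> s"
        using that by (auto simp: K_def)
      have M: "s' + t' \<in> ?M"
        using m(2-3) m(4)[rule_format, OF s'(1)] less.prems by (auto simp: monoms_of_deg_def block_deg_add intro: monoms_add)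
      have le: "(s' + t', t) \<in> r"
        using m(2-3) m(4)[rule_format, OF s'(1)] by (auto intro: term_order_add[OF r])
      have "s' + t' \<noteq> t"
        using m(2) s'(2) by simp
      then have "(t, s' + t') \<notin> r"
        using le term_order_antisym[OF r] by blast
      then have "{x \<in> ?M. (x, s' + t') \<in> r} \<subset> {x \<in> ?M. (x, t) \<in> r}"
        using le term_order_trans[OF r] less.prems term_order_refl[OF r tM] by blast
      then have "card {x \<in> ?M. (x, s' + t') \<in> r} < card {x \<in> ?M. (x, t) \<in> r}"
        using finite_monoms_of_deg[of n u] by (intro psubset_card_mono) auto
      from less.IH[OF this M] show ?thesis
        using le term_order_trans[OF r] by blast
    qed
    then have "\<forall>s'\<in>K. \<exists>d. ?P s' d"
      by (rule ballI)
    from bchoice[OF this] obtain D where D: "\<forall>s'\<in>K. ?P s' (D s')" ..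
    \<comment> \<open>Solving the relation \<open>m\<close> for its leading monomial
      \<open>s\<close> gives the coefficients \<open>k\<close>; substituting the normal forms of the
      other terms gives \<open>d\<close>.\<close>
    define k where "k s' = - (Poly_Mapping.lookup m s' / Poly_Mapping.lookup m s)" for s'
    define d where "d x = (\<Sum>s'\<in>K. k s' * D s' x)" for x
    have "low x \<and> (x, t) \<in> r" if "x \<in> ?M" "d x \<noteq> 0" for x
    proof -
      obtain s' where "s' \<in> K" "k s' * D s' x \<noteq> 0"
        using \<open>d x \<noteq> 0\<close> unfolding d_def by (metis (mono_tags, lifting) sum.neutral)
      then show ?thesis
        using D that(1) by auto
    qed
    moreover have "monom_val a t = (\<Sum>x\<in>?M. d x * monom_val a x)" if a: "a \<in> V" for a
    proof -
      have nz: "Poly_Mapping.lookup m s \<noteq> 0"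
        using m(1) by (simp add: in_keys_iff)
      have "Poly_Mapping.lookup m s * monom_val a s + (\<Sum>s'\<in>K. Poly_Mapping.lookup m s' * monom_val a s') = 0"
        using m(5)[rule_format, OF a] m(1) unfolding eval_poly_monom_val K_def by (subst sum.remove[symmetric]) auto
      then have "Poly_Mapping.lookup m s * monom_val a s = - (\<Sum>s'\<in>K. Poly_Mapping.lookup m s' * monom_val a s')"
        by (simp add: add_eq_0_iff2)
      then have "monom_val a s = - (\<Sum>s'\<in>K. Poly_Mapping.lookup m s' * monom_val a s') / Poly_Mapping.lookup m s"
        using nz by (metis nonzero_mult_div_cancel_left)
      then have "monom_val a s = (\<Sum>s'\<in>K. k s' * monom_val a s')"
        by (simp add: k_def sum_divide_distrib sum_negf)
      then have "monom_val a t = (\<Sum>s'\<in>K. k s' * monom_val a (s' + t'))"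
        unfolding m(2) by (simp add: monom_val_add sum_distrib_left mult_ac)
      also have "\<dots> = (\<Sum>s'\<in>K. k s' * (\<Sum>x\<in>?M. D s' x * monom_val a x))"
        using D a by (intro sum.cong) auto
      also have "\<dots> = (\<Sum>s'\<in>K. \<Sum>x\<in>?M. k s' * D s' x * monom_val a x)"
        by (simp add: sum_distrib_left mult.assoc)
      also have "\<dots> = (\<Sum>x\<in>?M. \<Sum>s'\<in>K. k s' * D s' x * monom_val a x)"
        by (rule sum.swap)
      also have "\<dots> = (\<Sum>x\<in>?M. d x * monom_val a x)"
        by (simp add: d_def sum_distrib_right)
      finally show ?thesis .
    qed
    ultimately show ?thesis
      using False by blast
  qed
qed

text \<open>Each variable of block \<open>i\<close> contributes one factor \<open>l i\<close>, so
  the exponents add up to the block degree.\<close>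

lemma monom_val_scale:
  assumes "t \<in> monoms n"
  shows "monom_val (\<lambda>(i, c). l i * a (i, c)) t = (\<Prod>i<n. l i ^ block_deg t i) * monom_val a t"
proof -
  have sub: "Poly_Mapping.keys t \<subseteq> {..<n} \<times> {..<3}"
    using assms by (simp add: monoms_def)
  have "monom_val (\<lambda>(i, c). l i * a (i, c)) t =
      (\<Prod>v\<in>{..<n} \<times> {..<3}. l (fst v) ^ Poly_Mapping.lookup t v) * monom_val a t"
    by (simp add: monom_val_superset[OF _ sub] power_mult_distrib prod.distrib split_beta)
  also have "(\<Prod>v\<in>{..<n} \<times> {..<3}. l (fst v) ^ Poly_Mapping.lookup t v) =
      (\<Prod>i<n. \<Prod>c<3. l i ^ Poly_Mapping.lookup t (i, c))"
    by (simp add: prod.cartesian_product split_beta)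
  also have "\<dots> = (\<Prod>i<n. l i ^ block_deg t i)"
    by (simp add: block_deg_def power_sum)
  finally show ?thesis .
qed

text \<open>The scales of the blocks vary independently over an infinite field, so the coefficient
  of every power of every scale vanishes. The blocks are treated one after the other:
  \<open>?K k\<close> has the degrees of the first \<open>k\<close> blocks fixed.\<close>

lemma multidegree_components_vanish:
  fixes f :: "'k::field mpoly"
  assumes inf: "infinite (UNIV :: 'k set)" and f: "f \<in> polys n"
    and van: "\<And>l. (\<And>i. i < n \<Longrightarrow> l i \<noteq> 0) \<Longrightarrow> eval_poly (\<lambda>(i, c). l i * a (i, c)) f = 0"
  shows "(\<Sum>t | t \<in> Poly_Mapping.keys f \<and> (\<forall>i<n. block_deg t i = u i).
    Poly_Mapping.lookup f t * monom_val a t) = 0"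
proof -
  let ?K = "\<lambda>k. {t \<in> Poly_Mapping.keys f. \<forall>i<k. block_deg t i = u i}"
  let ?w = "\<lambda>B l t. Poly_Mapping.lookup f t * monom_val a t * (\<Prod>i\<in>B. l i ^ block_deg t i)"
  have "(\<Sum>t\<in>?K k. ?w {..<n} l t) = 0" if "k \<le> n" "\<And>i. i < n \<Longrightarrow> l i \<noteq> 0" for k l
    using that
  proof (induction k arbitrary: l)
    case 0
    have "(\<Sum>t\<in>?K 0. ?w {..<n} l t) = eval_poly (\<lambda>(i, c). l i * a (i, c)) f"
      unfolding eval_poly_monom_val
      by (rule sum.cong) (use f in \<open>auto simp: polys_def monom_val_scale subset_iff\<close>)
    then show ?case
      using van 0 by simp
  next
    case (Suc k)
    \<comment> \<open>The sum as a polynomial in the scale of block \<open>k\<close>. It vanishes at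
      all nonzero scales, and its coefficient at \<open>u k\<close> is the part with the next degree
      fixed.\<close>
    define p where "p = (\<Sum>t\<in>?K k. Polynomial.monom (?w ({..<n} - {k}) l t) (block_deg t k))"
    have "poly p s = 0" if "s \<notin> {0}" for s
    proof -
      have "poly p s = (\<Sum>t\<in>?K k. ?w {..<n} (l(k := s)) t)"
        unfolding p_def poly_sum
      proof (rule sum.cong[OF refl])
        fix t
        have "(\<Prod>i<n. (l(k := s)) i ^ block_deg t i) = s ^ block_deg t k * (\<Prod>i\<in>{..<n} - {k}. l i ^ block_deg t i)"
          using Suc.prems(1) by (subst prod.remove[of _ k]) auto
        then show "poly (Polynomial.monom (?w ({..<n} - {k}) l t) (block_deg t k)) s = ?w {..<n} (l(k := s)) t"
          by (simp add: poly_monom mult_ac)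
      qed
      then show ?thesis
        using Suc.IH[of "l(k := s)"] Suc.prems that by auto
    qed
    then have "p = 0"
      by (intro poly_eq_0_if_infinite_roots[OF inf, of "{0}"]) auto
    then have "0 = Polynomial.coeff p (u k)"
      by simp
    also have "\<dots> = (\<Sum>t\<in>?K k. if block_deg t k = u k then ?w ({..<n} - {k}) l t else 0)"
      by (simp add: p_def coeff_sum)
    also have "\<dots> = (\<Sum>t\<in>{t \<in> ?K k. block_deg t k = u k}. ?w ({..<n} - {k}) l t)"
      by (rule sum.inter_filter[symmetric]) auto
    also have "{t \<in> ?K k. block_deg t k = u k} = ?K (Suc k)"
      by (auto simp: less_Suc_eq)
    finally have "(\<Sum>t\<in>?K (Suc k). ?w ({..<n} - {k}) l t) = 0"
      by simp
    moreover have "(\<Sum>t\<in>?K (Suc k). ?w {..<n} l t) = l k ^ u k * (\<Sum>t\<in>?K (Suc k). ?w ({..<n} - {k}) l t)"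
      unfolding sum_distrib_left
    proof (rule sum.cong[OF refl])
      fix t assume "t \<in> ?K (Suc k)"
      then have "(\<Prod>i<n. l i ^ block_deg t i) = l k ^ u k * (\<Prod>i\<in>{..<n} - {k}. l i ^ block_deg t i)"
        using Suc.prems(1) by (subst prod.remove[of _ k]) auto
      then show "?w {..<n} l t = l k ^ u k * ?w ({..<n} - {k}) l t"
        by simp
    qed
    ultimately show ?case
      by simp
  qed
  from this[of n "\<lambda>i. 1"] show ?thesis
    by simp
qed

text \<open>Replacing the terms of the multidegree of \<open>t\<close> by their normal forms gives a
  relation between low monomials, so all its coefficients are zero. If \<open>t\<close> were low,
  its coefficient would survive: the other terms are smaller, and rewriting them never produces
  anything larger.\<close>

lemma initial_monom_not_low:
  fixes V :: "(nat \<times> nat \<Rightarrow> 'k::field) set" and f :: "'k mpoly"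
  assumes inf: "infinite (UNIV :: 'k set)"
    and zero: "(\<lambda>v. 0) \<in> V"
    and lin: "\<And>a b x. a \<in> V \<Longrightarrow> b \<in> V \<Longrightarrow> (\<lambda>v. a v + x * b v) \<in> V"
    and dual: "\<And>J j. J \<subseteq> {..<n} \<times> {..<3} \<Longrightarrow> card J \<le> 4 \<Longrightarrow> j \<in> J \<Longrightarrow>
      \<exists>a\<in>V. a j = 1 \<and> (\<forall>j'\<in>J - {j}. a j' = 0)"
    and rk: "\<And>i. i < n \<Longrightarrow> bij_betw (rk i) {..<3} {..<3}"
    and r: "term_order n r"
    and rel: "\<And>t. t \<in> monoms n \<Longrightarrow> \<not> (\<Sum>i<n. height rk t i) < 4 \<Longrightarrow>
      \<exists>m s t'. s \<in> Poly_Mapping.keys m \<and> t = s + t' \<and> t' \<in> monoms n \<and>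
        (\<forall>s'\<in>Poly_Mapping.keys m. (s', s) \<in> r \<and> s' \<in> monoms n \<and> (\<forall>i<n. block_deg s' i = block_deg s i)) \<and>
        (\<forall>a\<in>V. eval_poly a m = 0)"
    and f: "f \<in> polys n"
    and van: "\<And>a l. a \<in> V \<Longrightarrow> (\<And>i. i < n \<Longrightarrow> \<exists>c<3. a (i, c) \<noteq> 0) \<Longrightarrow> (\<And>i. i < n \<Longrightarrow> l i \<noteq> 0) \<Longrightarrow>
      eval_poly (\<lambda>(i, c). l i * a (i, c)) f = 0"
    and t: "t \<in> Poly_Mapping.keys f" "\<And>s. s \<in> Poly_Mapping.keys f \<Longrightarrow> (s, t) \<in> r"
  shows "(\<Sum>i<n. height rk t i) \<ge> 4"
proof (rule ccontr)
  assume "\<not> (\<Sum>i<n. height rk t i) \<ge> 4"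
  let ?low = "\<lambda>t. (\<Sum>i<n. height rk t i) < 4"
  have low_t: "?low t"
    using \<open>\<not> (\<Sum>i<n. height rk t i) \<ge> 4\<close> by simp
  define u where "u = block_deg t"
  let ?M = "monoms_of_deg n u"
  define K where "K = {s \<in> Poly_Mapping.keys f. \<forall>i<n. block_deg s i = u i}"
  have "K \<subseteq> ?M"
    using f by (auto simp: K_def monoms_of_deg_def polys_def)
  let ?P = "\<lambda>t d. (\<forall>s\<in>?M. d s \<noteq> 0 \<longrightarrow> ?low s \<and> (s, t) \<in> r) \<and> (?low t \<longrightarrow> d t = 1) \<and>
    (\<forall>a\<in>V. monom_val a t = (\<Sum>s\<in>?M. d s * monom_val a s))"
  have "\<exists>d. ?P s d" if "s \<in> K" for s
    using that \<open>K \<subseteq> ?M\<close> by (intro normal_form[OF r rel]) auto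
  then have "\<forall>s\<in>K. \<exists>d. ?P s d"
    by (rule ballI)
  from bchoice[OF this] obtain D where "\<forall>s\<in>K. ?P s (D s)" ..
  then have D: "?P s (D s)" if "s \<in> K" for s
    using that by (rule bspec)
  define d where "d x = (\<Sum>s\<in>K. Poly_Mapping.lookup f s * D s x)" for x
  have tK: "t \<in> K"
    using t by (simp add: K_def u_def)
  then have tM: "t \<in> ?M"
    using \<open>K \<subseteq> ?M\<close> by blast
  have d0: "d x = 0" if "x \<in> ?M" "\<not> ?low x" for x
    unfolding d_def using D that by (intro sum.neutral) force
  have fin: "finite {x \<in> ?M. ?low x}"
    using finite_monoms_of_deg[of n u] by simp
  have "d t = 0"
  proof (rule low_monoms_independent_nonzero_blocks[where V = V and n = n and rk = rk and u = u
        and T = "{x \<in> ?M. ?low x}"], fact inf, fact zero)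
    fix a assume a: "a \<in> V" "\<And>i. i < n \<Longrightarrow> \<exists>c<3. a (i, c) \<noteq> 0"
    have "(\<Sum>x\<in>{x \<in> ?M. ?low x}. d x * monom_val a x) = (\<Sum>x\<in>?M. d x * monom_val a x)"
      using d0 finite_monoms_of_deg[of n u] by (intro sum.mono_neutral_left) auto
    also have "\<dots> = (\<Sum>x\<in>?M. \<Sum>s\<in>K. Poly_Mapping.lookup f s * D s x * monom_val a x)"
      by (simp add: d_def sum_distrib_right)
    also have "\<dots> = (\<Sum>s\<in>K. \<Sum>x\<in>?M. Poly_Mapping.lookup f s * D s x * monom_val a x)"
      by (rule sum.swap)
    also have "\<dots> = (\<Sum>s\<in>K. Poly_Mapping.lookup f s * monom_val a s)"
    proof (rule sum.cong[OF refl])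
      fix s assume "s \<in> K"
      then have "monom_val a s = (\<Sum>x\<in>?M. D s x * monom_val a x)"
        using D a(1) by blast
      then show "(\<Sum>x\<in>?M. Poly_Mapping.lookup f s * D s x * monom_val a x) =
          Poly_Mapping.lookup f s * monom_val a s"
        by (simp add: sum_distrib_left mult.assoc)
    qed
    also have "\<dots> = 0"
      unfolding K_def by (rule multidegree_components_vanish[OF inf f van[OF a]])
    finally show "(\<Sum>x\<in>{x \<in> ?M. ?low x}. d x * monom_val a x) = 0" .
  qed (use lin dual rk tM low_t fin in \<open>auto simp: monoms_of_deg_def\<close>)
  moreover have "d t = Poly_Mapping.lookup f t"
  proof -
    \<comment> \<open>Otherwise \<open>t\<close> would be at most \<open>s\<close>, while
      \<open>s\<close> is at most the leading monomial \<open>t\<close>.\<close>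
    have "D s t = 0" if "s \<in> K - {t}" for s
      using D[of s] that tM t(2)[of s] term_order_antisym[OF r, of s t] by (auto simp: K_def)
    then have "d t = Poly_Mapping.lookup f t * D t t"
      unfolding d_def using tK by (subst sum.remove[of K t]) (auto simp: K_def)
    then show ?thesis
      using D[OF tK] low_t by simp
  qed
  ultimately show False
    using t(1) by (simp add: in_keys_iff)
qed

section \<open>Generic cameras\<close>

text \<open>\<open>pick\<close> is the enumeration by which \<open>submatrix\<close> addresses its
  rows and columns.\<close>

lemma bij_betw_pick:
  assumes "finite S"
  shows "bij_betw (pick S) {..<card S} S"
proof -
  have "pick S ` {..<card S} = S"
  proof
    show "pick S ` {..<card S} \<subseteq> S"
      by (auto intro: pick_in_set)
    show "S \<subseteq> pick S ` {..<card S}"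
    proof
      fix x assume x: "x \<in> S"
      then have "card {a \<in> S. a < x} < card S"
        using assms by (intro psubset_card_mono) auto
      then show "x \<in> pick S ` {..<card S}"
        using pick_card_in_set[OF x] by (intro image_eqI[of _ _ "card {a \<in> S. a < x}"]) simp_all
    qed
  qed
  then show ?thesis
    unfolding bij_betw_def by (intro conjI eq_card_imp_inj_on) auto
qed

lemma pick_lessThan:
  assumes "i < k"
  shows "pick {..<k} i = i"
proof -
  have "{a \<in> {..<k}. a < i} = {..<i}"
    using assms by auto
  then show ?thesis
    using pick_card_in_set[of i "{..<k}"] assms by simp
qed

lemma submatrix_carrier:
  assumes "I \<subseteq> {..<dim_row M}" "J \<subseteq> {..<dim_col M}"
  shows "submatrix M I J \<in> carrier_mat (card I) (card J)"
proof -
  have "{i. i < dim_row M \<and> i \<in> I} = I" "{j. j < dim_col M \<and> j \<in> J} = J"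
    using assms by auto
  then show ?thesis
    by (intro carrier_matI) (simp_all add: dim_submatrix)
qed

lemma submatrix_nth:
  assumes "I \<subseteq> {..<dim_row M}" "J \<subseteq> {..<dim_col M}" "i < card I" "j < card J"
  shows "submatrix M I J $$ (i, j) = M $$ (pick I i, pick J j)"
proof -
  have "{i. i < dim_row M \<and> i \<in> I} = I" "{j. j < dim_col M \<and> j \<in> J} = J"
    using assms by auto
  then show ?thesis
    using assms by (intro submatrix_index) simp_all
qed

text \<open>Makes every summand of the expansion of a minor a single term.\<close>

lemma prod_single:
  "(\<Prod>i\<in>B. Poly_Mapping.single (t i) (c i)) =
    Poly_Mapping.single (sum t B) (prod c B :: 'k::comm_ring_1)"
  by (induction B rule: infinite_finite_induct) (simp_all add: mult_single)

locale generic_cameras =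
  fixes n :: nat and A :: "nat \<Rightarrow> 'k::field mat"
  assumes two_le: "2 \<le> n"
    and A_carrier: "\<And>i. i < n \<Longrightarrow> A i \<in> carrier_mat 3 4"
    and generic: "generic n A"
begin

text \<open>The rows of all cameras as \<open>3n\<close> linear forms on 4-space, read as an
  assignment to the unknowns. The value 0 at the other indices keeps it linear everywhere.\<close>

definition point :: "'k vec \<Rightarrow> nat \<times> nat \<Rightarrow> 'k" where
  "point x = (\<lambda>(i, c). if i < n \<and> c < 3 then row (A i) c \<bullet> x else 0)"

lemma point_linear:
  assumes "x \<in> carrier_vec 4" "y \<in> carrier_vec 4"
  shows "point (x + s \<cdot>\<^sub>v y) = (\<lambda>v. point x v + s * point y v)"
proof
  fix v :: "nat \<times> nat"
  obtain i c where v: "v = (i, c)"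
    by force
  have "row (A i) c \<bullet> (x + s \<cdot>\<^sub>v y) = row (A i) c \<bullet> x + s * (row (A i) c \<bullet> y)" if "i < n" "c < 3"
  proof -
    have "row (A i) c \<in> carrier_vec 4"
      using A_carrier[OF that(1)] that(2) by simp
    then show ?thesis
      using assms by (simp add: scalar_prod_add_distrib[of _ 4])
  qed
  then show "point (x + s \<cdot>\<^sub>v y) v = point x v + s * point y v"
    by (simp add: point_def v)
qed

lemma point_zero: "point (0\<^sub>v 4) = (\<lambda>v. 0)"
proof
  fix v :: "nat \<times> nat"
  obtain i c where v: "v = (i, c)"
    by force
  have "row (A i) c \<bullet> 0\<^sub>v 4 = 0" if "i < n" "c < 3"
    using A_carrier[OF that(1)] that(2) by (intro scalar_prod_right_zero) simp
  then show "point (0\<^sub>v 4) v = 0"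
    by (simp add: point_def v)
qed

text \<open>Four of the forms make up the transpose of a maximal square submatrix of the stacked
  cameras, invertible by genericity; \<open>f\<close> records the order in which they are
  listed.\<close>

lemma generic_coordinates:
  assumes J: "J \<subseteq> {..<n} \<times> {..<3}" "card J = 4"
  obtains P f where "P \<in> carrier_mat 4 4" "det P \<noteq> 0" "bij_betw f {..<4} J"
    "\<And>x q. x \<in> carrier_vec 4 \<Longrightarrow> q < 4 \<Longrightarrow> (P *\<^sub>v x) $ q = point x (f q)"
proof -
  \<comment> \<open>\<open>h\<close> is the column number of an unknown in the stacked cameras, and
    \<open>g\<close> inverts it.\<close>
  define h where "h = (\<lambda>(i, c). 3 * i + c :: nat)"
  define g where "g q = (q div 3, q mod 3 :: nat)" for q :: nat
  have gh: "g (h v) = v" if "v \<in> J" for v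
    using that J(1) by (auto simp: g_def h_def)
  have inj: "inj_on h J"
    using gh by (rule inj_on_inverseI)
  have fin: "finite (h ` J)"
    using J(2) by (simp add: card_ge_0_finite)
  have card: "card (h ` J) = 4"
    using card_image[OF inj] J(2) by simp
  let ?T = "transposed_cameras n A"
  have dims: "{..<4} \<subseteq> {..<dim_row ?T}" "h ` J \<subseteq> {..<dim_col ?T}"
    using J(1) by (auto simp: transposed_cameras_def h_def)
  let ?N = "submatrix ?T {..<4} (h ` J)"
  have N: "?N \<in> carrier_mat 4 4"
    using submatrix_carrier[OF dims] card by simp
  have "det ?N \<in> minors 4 ?T"
    unfolding minors_def using dims card
    by (intro CollectI exI[of _ "{..<4}"] exI[of _ "h ` J"] conjI refl) simp_all
  then have "det ?N \<noteq> 0"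
    using generic unfolding generic_def by (rule bspec[rotated])
  then have det: "det (transpose_mat ?N) \<noteq> 0"
    using det_transpose[OF N] by simp
  have bij: "bij_betw (\<lambda>q. g (pick (h ` J) q)) {..<4} J"
  proof -
    have "bij_betw (pick (h ` J)) {..<4} (h ` J)"
      using bij_betw_pick[OF fin] card by simp
    moreover have "bij_betw g (h ` J) J"
      by (rule bij_betw_byWitness[where f' = h]) (auto simp: gh)
    ultimately show ?thesis
      using bij_betw_trans by (fastforce simp: comp_def)
  qed
  have "(transpose_mat ?N *\<^sub>v x) $ q = point x (g (pick (h ` J) q))"
    if x: "x \<in> carrier_vec 4" and q: "q < 4" for x q
  proof -
    obtain i c where v: "g (pick (h ` J) q) = (i, c)"
      by force
    then have ic: "i < n" "c < 3"
      using bij_betwE[OF bij] q J(1) by force+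
    have T: "?N $$ (p, q) = A i $$ (c, p)" if "p < 4" for p
    proof -
      have "pick (h ` J) q < dim_col ?T"
        using pick_in_set[of q "h ` J"] q card dims(2) by auto
      then show ?thesis
        using submatrix_nth[OF dims, of p q] that q card v ic A_carrier[OF ic(1)]
        by (auto simp: pick_lessThan transposed_cameras_def g_def)
    qed
    have "row (transpose_mat ?N) q = row (A i) c"
      using N q T ic A_carrier[OF ic(1)] by (intro eq_vecI) auto
    then show ?thesis
      using N q v ic by (simp add: point_def)
  qed
  with N det bij show thesis
    by (intro that[of "transpose_mat ?N"]) auto
qed

lemma point_eq_zero:
  assumes J: "J \<subseteq> {..<n} \<times> {..<3}" "card J = 4"
    and x: "x \<in> carrier_vec 4" "\<And>v. v \<in> J \<Longrightarrow> point x v = 0"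
  shows "x = 0\<^sub>v 4"
proof -
  obtain P f where P: "P \<in> carrier_mat 4 4" "det P \<noteq> 0" "bij_betw f {..<4} J"
    "\<And>x q. x \<in> carrier_vec 4 \<Longrightarrow> q < 4 \<Longrightarrow> (P *\<^sub>v x) $ q = point x (f q)"
    using generic_coordinates[OF J] by blast
  have "P *\<^sub>v x = 0\<^sub>v 4"
    using P x bij_betwE[OF P(3)] by (intro eq_vecI) auto
  then show ?thesis
    using det_0_iff_vec_prod_zero[OF P(1)] P(2) x(1) by blast
qed

text \<open>Once \<open>J\<close> is completed to four forms, these are coordinates, and a column of
  the inverse matrix is the required dual basis vector.\<close>

lemma point_dual:
  assumes J: "J \<subseteq> {..<n} \<times> {..<3}" "card J \<le> 4" and j: "j \<in> J"
  shows "\<exists>a\<in>point ` carrier_vec 4. a j = 1 \<and> (\<forall>j'\<in>J - {j}. a j' = 0)"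
proof -
  have fin: "finite J"
    using J(1) by (rule finite_subset) auto
  \<comment> \<open>Two cameras already provide six forms, so \<open>J\<close> can be completed to
    four.\<close>
  have "4 \<le> card ({..<n} \<times> {..<3::nat})"
    using two_le by simp
  then obtain K where K: "J \<subseteq> K" "K \<subseteq> {..<n} \<times> {..<3}" "card K = 4"
    using exists_subset_between[of J 4 "{..<n} \<times> {..<3::nat}"] J by auto
  obtain P f where P: "P \<in> carrier_mat 4 4" "det P \<noteq> 0" "bij_betw f {..<4} K"
    "\<And>x q. x \<in> carrier_vec 4 \<Longrightarrow> q < 4 \<Longrightarrow> (P *\<^sub>v x) $ q = point x (f q)"
    using generic_coordinates[OF K(2,3)] by blast
  have "P \<in> Units (ring_mat TYPE('k) 4 undefined)"
    by (rule det_non_zero_imp_unit[OF P(1,2)])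
  then obtain Q where Q: "Q \<in> carrier_mat 4 4" "P * Q = 1\<^sub>m 4"
    by (auto simp: Units_def ring_mat_def)
  have "j \<in> K"
    using j K(1) by blast
  then obtain q where q: "q < 4" "f q = j"
    using P(3) unfolding bij_betw_def by blast
  have x: "col Q q \<in> carrier_vec 4"
    using Q(1) q by simp
  have val: "point (col Q q) (f p) = (if p = q then 1 else 0)" if "p < 4" for p
  proof -
    have "point (col Q q) (f p) = (P * Q) $$ (p, q)"
      using P(1) Q(1) q that by (subst P(4)[OF x that, symmetric]) simp
    then show ?thesis
      using Q(2) that q by simp
  qed
  show ?thesis
  proof (intro bexI[of _ "point (col Q q)"] conjI ballI)
    show "point (col Q q) j = 1"
      using val[OF q(1)] q(2) by simp
    fix j' assume "j' \<in> J - {j}"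
    then have "j' \<in> K" "j' \<noteq> j"
      using K(1) by auto
    then obtain p where "p < 4" "f p = j'"
      using P(3) unfolding bij_betw_def by blast
    then show "point (col Q q) j' = 0"
      using val[of p] q(2) \<open>j' \<noteq> j\<close> by auto
  qed (use x in simp)
qed


section \<open>Minors of the matrices \<open>A\<^sub>\<sigma>\<close>\<close>

definition minor :: "nat set \<Rightarrow> nat set \<Rightarrow> 'k mpoly" where
  "minor \<sigma> I = det (submatrix (camera_matrix A \<sigma>) I {..<card \<sigma> + 4})"

text \<open>The matrix has exactly \<open>card \<sigma> + 4\<close> columns, so only the rows can be
  chosen.\<close>

lemma maximal_minors_eq:
  "maximal_minors A \<sigma> = {minor \<sigma> I | I. I \<subseteq> {..<3 * card \<sigma>} \<and> card I = card \<sigma> + 4}"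
proof -
  have "J \<subseteq> {..<card \<sigma> + 4} \<and> card J = card \<sigma> + 4 \<longleftrightarrow> J = {..<card \<sigma> + 4}" for J :: "nat set"
    using card_subset_eq[of "{..<card \<sigma> + 4}" J] by auto
  moreover have "dim_row (camera_matrix A \<sigma>) = 3 * card \<sigma>" "dim_col (camera_matrix A \<sigma>) = card \<sigma> + 4"
    by (simp_all add: camera_matrix_def)
  ultimately show ?thesis
    unfolding maximal_minors_def minors_def minor_def by auto
qed

context
  fixes \<sigma> I :: "nat set"
  assumes sigma: "\<sigma> \<subseteq> {..<n}" and I: "I \<subseteq> {..<3 * card \<sigma>}" "card I = card \<sigma> + 4"
begin

private abbreviation "s \<equiv> card \<sigma>"
private abbreviation "cam j \<equiv> sorted_list_of_set \<sigma> ! j"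
private abbreviation "N \<equiv> submatrix (camera_matrix A \<sigma>) I {..<card \<sigma> + 4}"

lemma bij_betw_nth_sorted: "bij_betw (\<lambda>j. cam j) {..<s} \<sigma>"
proof -
  have "finite \<sigma>"
    using sigma by (rule finite_subset) auto
  then show ?thesis
    using bij_betw_nth[of "sorted_list_of_set \<sigma>" "{..<s}" \<sigma>] by simp
qed

lemma finite_rows: "finite I"
  using I(1) by (rule finite_subset) auto

lemma cam_less: "j < s \<Longrightarrow> cam j < n"
  using bij_betwE[OF bij_betw_nth_sorted] sigma by auto

lemma row_in_range: "q \<in> I \<Longrightarrow> q < 3 * s" "q \<in> I \<Longrightarrow> q div 3 < s"
  using I(1) by auto

lemma dims: "I \<subseteq> {..<dim_row (camera_matrix A \<sigma>)}" "{..<s + 4} \<subseteq> {..<dim_col (camera_matrix A \<sigma>)}"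
  using I(1) by (auto simp: camera_matrix_def)

lemma N_carrier: "N \<in> carrier_mat (s + 4) (s + 4)"
  using submatrix_carrier[OF dims] I(2) by simp

lemma pick_I: "r < s + 4 \<Longrightarrow> pick I r \<in> I"
  using pick_in_set[of r I] I(2) by simp

text \<open>Row \<open>q\<close> of the full matrix is the row for coordinate \<open>q mod 3\<close>
  of the camera in position \<open>q div 3\<close> of \<open>\<sigma>\<close>.\<close>

lemma N_nth:
  assumes "r < s + 4" "c < s + 4"
  shows "N $$ (r, c) = (if c < 4 then Const (A (cam (pick I r div 3)) $$ (pick I r mod 3, c))
    else if c = 4 + pick I r div 3 then Var (cam (pick I r div 3), pick I r mod 3) else 0)"
proof -
  have "N $$ (r, c) = camera_matrix A \<sigma> $$ (pick I r, c)"
    using submatrix_nth[OF dims, of r c] assms I(2) by (simp add: pick_lessThan)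
  then show ?thesis
    using row_in_range(1)[OF pick_I[OF assms(1)]] assms
    by (simp add: camera_matrix_def Let_def)
qed

text \<open>In the expansion of the determinant each column beyond the fourth contributes a variable
  of its own camera from a chosen row, and the first four columns contribute constants.\<close>

lemma keys_minor:
  assumes "t \<in> Poly_Mapping.keys (minor \<sigma> I)"
  shows "\<exists>c. t = (\<Sum>j<s. Poly_Mapping.single (cam j, c j) 1) \<and> (\<forall>j<s. c j < 3 \<and> 3 * j + c j \<in> I)"
proof -
  have "minor \<sigma> I = (\<Sum>p\<in>{p. p permutes {0..<s + 4}}. signof p * (\<Prod>r = 0..<s + 4. N $$ (r, p r)))"
    unfolding minor_def by (rule det_def'[OF N_carrier])
  with assms obtain p where p: "p permutes {0..<s + 4}"
    "t \<in> Poly_Mapping.keys (signof p * (\<Prod>r = 0..<s + 4. N $$ (r, p r)))"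
    using Poly_Mapping.keys_sum by (metis (no_types, lifting) UN_E mem_Collect_eq subsetD)
  have "Poly_Mapping.keys (signof p * f) = Poly_Mapping.keys f" for f :: "'k mpoly"
    by (auto simp: sign_def in_keys_iff)
  with p(2) have tp: "t \<in> Poly_Mapping.keys (\<Prod>r = 0..<s + 4. N $$ (r, p r))"
    by blast
  define q where "q r = pick I r" for r
  \<comment> \<open>Each entry is a single term with monomial \<open>mo r\<close> and coefficient
    \<open>co r\<close>; a zero entry is recorded by the coefficient alone.\<close>
  define mo where "mo r = (if 4 \<le> p r then Poly_Mapping.single (cam (q r div 3), q r mod 3) (1 :: nat) else 0)" for r
  define co where "co r = (if p r < 4 then A (cam (q r div 3)) $$ (q r mod 3, p r)
    else if p r = 4 + q r div 3 then 1 else 0)" for r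
  have p_less: "p r < s + 4" if "r < s + 4" for r
    using permutes_in_image[OF p(1), of r] that by simp
  have "N $$ (r, p r) = Poly_Mapping.single (mo r) (co r)" if "r < s + 4" for r
    using N_nth[OF that p_less[OF that]]
    by (auto simp: mo_def co_def q_def Const_def Var_def)
  then have prod: "(\<Prod>r = 0..<s + 4. N $$ (r, p r)) = Poly_Mapping.single (\<Sum>r = 0..<s + 4. mo r) (\<Prod>r = 0..<s + 4. co r)"
    by (subst prod_single[symmetric]) (intro prod.cong, auto)
  have t: "t = (\<Sum>r = 0..<s + 4. mo r)" and "(\<Prod>r = 0..<s + 4. co r) \<noteq> 0"
    using tp unfolding prod by (auto simp: in_keys_iff lookup_single when_def split: if_splits)
  then have co: "co r \<noteq> 0" if "r < s + 4" for r
    using that by auto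
  have match: "q r div 3 = p r - 4" if "r < s + 4" "4 \<le> p r" for r
    using co[OF that(1)] that(2) by (auto simp: co_def split: if_splits)
  \<comment> \<open>The row that the permutation matches with the variable column
    \<open>4 + j\<close>.\<close>
  define i where "i j = inv_into UNIV p (4 + j)" for j
  have i: "i j < s + 4" "p (i j) = 4 + j" if "j < s" for j
  proof -
    show pi: "p (i j) = 4 + j"
      unfolding i_def using permutes_inverses(1)[OF p(1)] by simp
    show "i j < s + 4"
      using permutes_in_image[OF p(1), of "i j"] pi that by simp
  qed
  define c where "c j = q (i j) mod 3" for j
  have c: "3 * j + c j = q (i j)" if "j < s" for j
    using match[of "i j"] i[OF that] unfolding c_def
    by (metis add_diff_cancel_left' div_mult_mod_eq le_add1 mult.commute)
  have "t = (\<Sum>r\<in>{r \<in> {0..<s + 4}. 4 \<le> p r}. Poly_Mapping.single (cam (q r div 3), q r mod 3) 1)"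
    unfolding t mo_def by (rule sum.inter_filter[symmetric]) simp
  also have "\<dots> = (\<Sum>j<s. Poly_Mapping.single (cam j, c j) 1)"
  proof (rule sum.reindex_bij_witness[where i = i and j = "\<lambda>r. p r - 4"])
    fix r assume r: "r \<in> {r \<in> {0..<s + 4}. 4 \<le> p r}"
    then show ir: "i (p r - 4) = r"
      unfolding i_def using permutes_inverses(2)[OF p(1)] by simp
    show "p r - 4 \<in> {..<s}"
      using r p_less[of r] by auto
    show "Poly_Mapping.single (cam (p r - 4), c (p r - 4)) 1 = Poly_Mapping.single (cam (q r div 3), q r mod 3) (1 :: nat)"
      using r match[of r] ir by (simp add: c_def)
  qed (use i in auto)
  finally have "t = (\<Sum>j<s. Poly_Mapping.single (cam j, c j) 1)" .
  moreover have "c j < 3 \<and> 3 * j + c j \<in> I" if "j < s" for j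
    using c[OF that] pick_I[OF i(1)[OF that]] by (simp add: c_def q_def)
  ultimately show ?thesis
    by blast
qed

text \<open>A vector of the kernel of \<open>A\<^sub>\<sigma>\<close> consists of a world point \<open>x\<close> and of a scale for every image.\<close>

lemma eval_minor_eq_0_iff:
  "eval_poly a (minor \<sigma> I) = 0 \<longleftrightarrow> (\<exists>v \<in> carrier_vec (s + 4). v \<noteq> 0\<^sub>v (s + 4) \<and>
    (\<forall>q\<in>I. point (vec 4 (\<lambda>c. v $ c)) (cam (q div 3), q mod 3) +
      a (cam (q div 3), q mod 3) * v $ (4 + q div 3) = 0))"
proof -
  let ?N = "map_mat (eval_poly a) N"
  let ?e = "\<lambda>v q. point (vec 4 (\<lambda>c. v $ c)) (cam (q div 3), q mod 3) +
    a (cam (q div 3), q mod 3) * v $ (4 + q div 3)"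
  have N': "?N \<in> carrier_mat (s + 4) (s + 4)"
    using N_carrier by simp
  have row: "(?N *\<^sub>v v) $ r = ?e v (pick I r)" if v: "v \<in> carrier_vec (s + 4)" and r: "r < s + 4" for v r
  proof -
    let ?q = "pick I r"
    have q: "?q div 3 < s" "cam (?q div 3) < n"
      using row_in_range(2)[OF pick_I[OF r]] cam_less by auto
    have "(?N *\<^sub>v v) $ r = (\<Sum>c = 0..<s + 4. eval_poly a (N $$ (r, c)) * v $ c)"
      using N' N_carrier v r by (simp add: scalar_prod_def)
    also have "\<dots> = (\<Sum>c = 0..<4. eval_poly a (N $$ (r, c)) * v $ c) +
        (\<Sum>c = 4..<s + 4. eval_poly a (N $$ (r, c)) * v $ c)"
      by (simp add: sum.atLeastLessThan_concat)
    also have "(\<Sum>c = 0..<4. eval_poly a (N $$ (r, c)) * v $ c) =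
        (\<Sum>c = 0..<4. A (cam (?q div 3)) $$ (?q mod 3, c) * v $ c)"
      by (rule sum.cong) (use r in \<open>auto simp: N_nth Const_def\<close>)
    also have "\<dots> = point (vec 4 (\<lambda>c. v $ c)) (cam (?q div 3), ?q mod 3)"
      using q A_carrier[OF q(2)] by (simp add: point_def scalar_prod_def)
    also have "(\<Sum>c = 4..<s + 4. eval_poly a (N $$ (r, c)) * v $ c) =
        (\<Sum>c = 4..<s + 4. if c = 4 + ?q div 3 then a (cam (?q div 3), ?q mod 3) * v $ c else 0)"
      by (rule sum.cong) (use r in \<open>auto simp: N_nth Var_def\<close>)
    also have "\<dots> = a (cam (?q div 3), ?q mod 3) * v $ (4 + ?q div 3)"
      using q by simp
    finally show ?thesis .
  qed
  have "?N *\<^sub>v v = 0\<^sub>v (s + 4) \<longleftrightarrow> (\<forall>q\<in>I. ?e v q = 0)" if v: "v \<in> carrier_vec (s + 4)" for v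
  proof -
    have "?N *\<^sub>v v = 0\<^sub>v (s + 4) \<longleftrightarrow> (\<forall>r<s + 4. (?N *\<^sub>v v) $ r = 0)"
      using N' by (auto intro!: eq_vecI simp del: index_mult_mat_vec)
    also have "\<dots> \<longleftrightarrow> (\<forall>r<s + 4. ?e v (pick I r) = 0)"
      using row[OF v] by simp
    also have "\<dots> \<longleftrightarrow> (\<forall>q\<in>pick I ` {..<s + 4}. ?e v q = 0)"
      by blast
    also have "pick I ` {..<s + 4} = I"
      using bij_betw_pick[OF finite_rows] I(2) by (simp add: bij_betw_def)
    finally show ?thesis .
  qed
  then have "det ?N = 0 \<longleftrightarrow> (\<exists>v \<in> carrier_vec (s + 4). v \<noteq> 0\<^sub>v (s + 4) \<and> (\<forall>q\<in>I. ?e v q = 0))"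
    unfolding det_0_iff_vec_prod_zero[OF N'] by blast
  then show ?thesis
    by (simp add: minor_def)
qed

text \<open>The world point \<open>x\<close> with the scales \<open>- 1 / l\<close> is a kernel
  vector. Its scale entries are nonzero, so it is a nonzero vector even for
  \<open>x = 0\<close>.\<close>

lemma eval_minor_point:
  assumes x: "x \<in> carrier_vec 4" and l: "\<And>i. i < n \<Longrightarrow> l i \<noteq> 0"
    and a: "\<And>i c. i < n \<Longrightarrow> c < 3 \<Longrightarrow> a (i, c) = l i * point x (i, c)" and "\<sigma> \<noteq> {}"
  shows "eval_poly a (minor \<sigma> I) = 0"
proof -
  define v where "v = vec (s + 4) (\<lambda>c. if c < 4 then x $ c else - 1 / l (cam (c - 4)))"
  have "finite \<sigma>"
    using sigma by (rule finite_subset) auto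
  then have s: "0 < s"
    using \<open>\<sigma> \<noteq> {}\<close> by (simp add: card_gt_0_iff)
  have "v $ 4 \<noteq> 0"
    using s l[OF cam_less[OF s]] by (simp add: v_def)
  then have "v \<noteq> 0\<^sub>v (s + 4)"
    using s by auto
  moreover have "vec 4 (\<lambda>c. v $ c) = x"
    using x by (intro eq_vecI) (auto simp: v_def)
  moreover have "point x (cam (q div 3), q mod 3) + a (cam (q div 3), q mod 3) * v $ (4 + q div 3) = 0"
    if "q \<in> I" for q
  proof -
    have "q div 3 < s" "cam (q div 3) < n"
      using row_in_range(2)[OF that] cam_less by auto
    then show ?thesis
      using l[of "cam (q div 3)"] by (simp add: v_def a)
  qed
  moreover have "v \<in> carrier_vec (s + 4)"
    by (simp add: v_def)
  ultimately show ?thesis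
    unfolding eval_minor_eq_0_iff by (intro bexI[of _ v]) auto
qed

text \<open>
  By \<open>keys_minor\<close>, evaluation at a 0/1-point which selects one variable of every block extracts a
  single coefficient.
\<close>

lemma monom_in_keys_minor:
  assumes c: "\<And>j. j < s \<Longrightarrow> c j < 3 \<and> 3 * j + c j \<in> I"
  shows "(\<Sum>j<s. Poly_Mapping.single (cam j, c j) 1) \<in> Poly_Mapping.keys (minor \<sigma> I)"
proof (rule ccontr)
  let ?t = "\<lambda>c. \<Sum>j<s. Poly_Mapping.single (cam j, c j) (1 :: nat)"
  assume notin: "?t c \<notin> Poly_Mapping.keys (minor \<sigma> I)"
  define a :: "nat \<times> nat \<Rightarrow> 'k" where "a v = (if \<exists>j<s. v = (cam j, c j) then 1 else 0)" for v
  have cam_inj: "j = j'" if "cam j = cam j'" "j < s" "j' < s" for j j'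
    using inj_onD[OF bij_betw_imp_inj_on[OF bij_betw_nth_sorted] that(1)] that(2,3) by simp
  have a: "a (cam j, d) = (if d = c j then 1 else 0)" if "j < s" for j d
    using that by (auto simp: a_def dest: cam_inj)
  have "monom_val a t = 0" if t: "t \<in> Poly_Mapping.keys (minor \<sigma> I)" for t
  proof -
    obtain d where d: "t = ?t d"
      using keys_minor[OF t] by blast
    have "\<exists>j<s. d j \<noteq> c j"
    proof (rule ccontr)
      assume "\<not> (\<exists>j<s. d j \<noteq> c j)"
      then have "?t d = ?t c"
        by (intro sum.cong) auto
      then show False
        using t notin d by simp
    qed
    then show ?thesis
      by (auto simp: d monom_val_sum a)
  qed
  then have "eval_poly a (minor \<sigma> I) = 0"
    by (simp add: eval_poly_monom_val)
  then obtain v where v: "v \<in> carrier_vec (s + 4)" "v \<noteq> 0\<^sub>v (s + 4)"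
    "\<And>q. q \<in> I \<Longrightarrow> point (vec 4 (\<lambda>c. v $ c)) (cam (q div 3), q mod 3) +
      a (cam (q div 3), q mod 3) * v $ (4 + q div 3) = 0"
    unfolding eval_minor_eq_0_iff by blast
  let ?x = "vec 4 (\<lambda>c. v $ c)"
  \<comment> \<open>The rows of the selected variables. In the four remaining rows the scale term
    drops out, so genericity forces the world point to be zero; then the rows in \<open>?C\<close>
    force the scales to be zero.\<close>
  let ?C = "(\<lambda>j. 3 * j + c j) ` {..<s}"
  let ?f = "\<lambda>q. (cam (q div 3), q mod 3)"
  have C: "(3 * j + c j) div 3 = j" "(3 * j + c j) mod 3 = c j" if "j < s" for j
    using c[OF that] by auto
  have "?x = 0\<^sub>v 4"
  proof (rule point_eq_zero)
    have "inj_on ?f I"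
    proof (rule inj_onI)
      fix p q assume pq: "p \<in> I" "q \<in> I" "?f p = ?f q"
      then have "p div 3 = q div 3"
        using cam_inj row_in_range(2) by blast
      then show "p = q"
        using pq(3) by (metis div_mult_mod_eq prod.inject)
    qed
    moreover have "card (I - ?C) = 4"
    proof -
      have "card ?C = s"
        using C by (subst card_image) (auto intro: inj_on_inverseI[where g = "\<lambda>q. q div 3"])
      moreover have "?C \<subseteq> I"
        using c by auto
      ultimately show ?thesis
        using I(2) by (simp add: card_Diff_subset)
    qed
    ultimately show "card (?f ` (I - ?C)) = 4"
      by (subst card_image) (auto intro: inj_on_subset)
    show "?f ` (I - ?C) \<subseteq> {..<n} \<times> {..<3}"
      using row_in_range(2) cam_less by auto
    fix u assume "u \<in> ?f ` (I - ?C)"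
    then obtain q where q: "q \<in> I" "q \<notin> ?C" "u = ?f q"
      by blast
    have "q mod 3 \<noteq> c (q div 3)"
    proof
      assume "q mod 3 = c (q div 3)"
      then have "q = 3 * (q div 3) + c (q div 3)"
        by (metis div_mult_mod_eq mult.commute)
      then show False
        using q(1,2) row_in_range(2)[OF q(1)] by blast
    qed
    then show "point ?x u = 0"
      using v(3)[OF q(1)] a[OF row_in_range(2)[OF q(1)]] q(3) by simp
  qed simp
  then have v0: "v $ k = 0" if "k < 4" for k
    using that by (metis index_vec index_zero_vec(1))
  have v1: "v $ (4 + j) = 0" if "j < s" for j
    using v(3)[of "3 * j + c j"] c[OF that] C[OF that] a[OF that] \<open>?x = 0\<^sub>v 4\<close> point_zero
    by simp
  have "v $ k = 0" if "k < s + 4" for k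
  proof (cases "k < 4")
    case False
    then show ?thesis
      using v1[of "k - 4"] that by simp
  qed (rule v0)
  then have "v = 0\<^sub>v (s + 4)"
    using v(1) by (intro eq_vecI) auto
  then show False
    using v(2) by simp
qed

end

end

lemma eval_poly_cong:
  assumes "f \<in> polys n" "\<And>i c. i < n \<Longrightarrow> c < 3 \<Longrightarrow> a (i, c) = b (i, c)"
  shows "eval_poly a f = eval_poly b f"
proof -
  have "monom_val a t = monom_val b t" if "t \<in> Poly_Mapping.keys f" for t
  proof -
    have "Poly_Mapping.keys t \<subseteq> {..<n} \<times> {..<3}"
      using assms(1) that by (auto simp: polys_def monoms_def)
    then show ?thesis
      unfolding monom_val_def using assms(2) by (intro prod.cong) auto
  qed
  then show ?thesis
    by (simp add: eval_poly_monom_val)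
qed

text \<open>Units are added one at a time wherever an entry is still below its bound. It serves to
  cut a total height down to exactly 4.\<close>

lemma sum_nat_below:
  fixes m :: "'a \<Rightarrow> nat"
  assumes "finite B" "k \<le> sum m B"
  shows "\<exists>w. (\<forall>i\<in>B. w i \<le> m i) \<and> sum w B = k"
  using assms(2)
proof (induction k)
  case 0
  then show ?case
    by (intro exI[of _ "\<lambda>i. 0"]) simp
next
  case (Suc k)
  then obtain w where w: "\<forall>i\<in>B. w i \<le> m i" "sum w B = k"
    by auto
  have "\<exists>i\<in>B. w i < m i"
  proof (rule ccontr)
    assume "\<not> (\<exists>i\<in>B. w i < m i)"
    then have "sum m B \<le> sum w B"
      by (intro sum_mono) (simp add: not_less)
    then show False
      using w(2) Suc.prems by simp
  qed
  then obtain i where i: "i \<in> B" "w i < m i"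
    by blast
  have "sum (w(i := Suc (w i))) B = Suc (sum w B)"
    using assms(1) i(1) by (simp add: sum.remove[of B i])
  then show ?case
    using w i by (intro exI[of _ "w(i := Suc (w i))"]) simp
qed

context generic_cameras
begin

context
  fixes \<sigma> I :: "nat set"
  assumes sigma: "\<sigma> \<subseteq> {..<n}" and I: "I \<subseteq> {..<3 * card \<sigma>}" "card I = card \<sigma> + 4"
begin

text \<open>A term takes one variable from each camera of \<open>\<sigma>\<close>, so its
  multidegree is the indicator of \<open>\<sigma>\<close>, the same for all terms.\<close>

lemma keys_minor_monoms:
  assumes "t \<in> Poly_Mapping.keys (minor \<sigma> I)"
  shows "t \<in> monoms n"
    and "block_deg t i = (\<Sum>j<card \<sigma>. if sorted_list_of_set \<sigma> ! j = i then 1 else 0)"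
proof -
  obtain c where t: "t = (\<Sum>j<card \<sigma>. Poly_Mapping.single (sorted_list_of_set \<sigma> ! j, c j) 1)"
    and c: "\<And>j. j < card \<sigma> \<Longrightarrow> c j < 3"
    using keys_minor[OF sigma I assms] by blast
  show "t \<in> monoms n"
    unfolding t using cam_less[OF sigma I] c by (intro monoms_sum monoms_single) auto
  show "block_deg t i = (\<Sum>j<card \<sigma>. if sorted_list_of_set \<sigma> ! j = i then 1 else 0)"
    unfolding t block_deg_sum using c by (intro sum.cong) (auto simp: block_deg_single)
qed

lemma minor_in_polys: "minor \<sigma> I \<in> polys n"
  using keys_minor_monoms(1) by (auto simp: polys_def)

lemma minor_multihomogeneous: "multihomogeneous n (minor \<sigma> I)"
  unfolding multihomogeneous_def using keys_minor_monoms(2) by (auto simp: block_deg_def)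

end

section \<open>Image points in coordinates and membership in the multiview ideal\<close>

lemma image_proj_pt:
  assumes "i < n" "x \<in> carrier_vec 4"
  shows "(\<lambda>v. A i *\<^sub>v v) ` proj_pt x = {l \<cdot>\<^sub>v (A i *\<^sub>v x) | l. l \<noteq> 0}"
proof -
  have "(\<lambda>v. A i *\<^sub>v v) ` proj_pt x = {A i *\<^sub>v (l \<cdot>\<^sub>v x) | l. l \<noteq> 0}"
    unfolding proj_pt_def by blast
  then show ?thesis
    by (simp only: mult_mat_vec[OF A_carrier[OF assms(1)] assms(2)])
qed

lemma index_image_point:
  assumes "i < n" "c < 3"
  shows "(A i *\<^sub>v x) $ c = point x (i, c)"
  using assms A_carrier[OF assms(1)] by (simp add: point_def)

lemma multiview_map_vectors:
  assumes "x \<in> carrier_vec 4" and "\<And>i. i < n \<Longrightarrow> u i \<in> multiview_map n A (proj_pt x) i"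
  obtains l where "\<And>i. i < n \<Longrightarrow> l i \<noteq> 0" "\<And>i c. i < n \<Longrightarrow> c < 3 \<Longrightarrow> u i $ c = l i * point x (i, c)"
proof -
  have "\<exists>l. l \<noteq> 0 \<and> (\<forall>c<3. u i $ c = l * point x (i, c))" if i: "i < n" for i
  proof -
    obtain l where "l \<noteq> 0" "u i = l \<cdot>\<^sub>v (A i *\<^sub>v x)"
      using assms(2)[OF i] i image_proj_pt[OF i assms(1)] by (auto simp: multiview_map_def)
    then show ?thesis
      using A_carrier[OF i] index_image_point[OF i, of _ x]
      by (intro exI[of _ l]) (auto simp del: index_mult_mat_vec)
  qed
  then show thesis
    using that by metis
qed

text \<open>Closed sets are subsets of \<open>proj_planes n\<close>, so this is part of showing that
  one contains the image.\<close>

lemma multiview_map_in_proj_planes: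
  assumes "Q \<in> multiview_domain n A"
  shows "multiview_map n A Q \<in> proj_planes n"
proof -
  obtain x where x: "Q = proj_pt x" "x \<in> carrier_vec 4"
    using assms by (auto simp: multiview_domain_def proj_space_def)
  have "x \<in> Q"
    unfolding x(1) proj_pt_def by (intro CollectI exI[of _ 1]) simp
  have "(\<lambda>v. A i *\<^sub>v v) ` Q \<in> proj_space 2" if i: "i < n" for i
  proof -
    have "A i *\<^sub>v x \<noteq> 0\<^sub>v 3"
      using assms \<open>x \<in> Q\<close> i by (simp add: multiview_domain_def)
    moreover have "A i *\<^sub>v x \<in> carrier_vec 3"
      using A_carrier[OF i] by (intro carrier_vecI) simp
    ultimately show ?thesis
      unfolding x(1) image_proj_pt[OF i x(2)] proj_space_def
      by (intro image_eqI[of _ _ "A i *\<^sub>v x"]) (auto simp: proj_pt_def)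
  qed
  then show ?thesis
    by (auto simp: multiview_map_def proj_planes_def)
qed

text \<open>The zero set of one multihomogeneous minor is closed and contains the image, hence
  contains its closure.\<close>

lemma minor_in_multiview_ideal:
  assumes sigma: "\<sigma> \<subseteq> {..<n}" "\<sigma> \<noteq> {}" and I: "I \<subseteq> {..<3 * card \<sigma>}" "card I = card \<sigma> + 4"
  shows "minor \<sigma> I \<in> multiview_ideal n A"
proof -
  let ?Z = "{P \<in> proj_planes n. \<forall>f\<in>{minor \<sigma> I}. vanishes_at n f P}"
  have "vanishes_at n (minor \<sigma> I) (multiview_map n A Q)" if "Q \<in> multiview_domain n A" for Q
    unfolding vanishes_at_def
  proof (intro allI impI)
    fix u assume u: "\<forall>i<n. u i \<in> multiview_map n A Q i"
    obtain x where x: "Q = proj_pt x" "x \<in> carrier_vec 4"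
      using \<open>Q \<in> _\<close> by (auto simp: multiview_domain_def proj_space_def)
    obtain l where "\<And>i. i < n \<Longrightarrow> l i \<noteq> 0" "\<And>i c. i < n \<Longrightarrow> c < 3 \<Longrightarrow> u i $ c = l i * point x (i, c)"
      using multiview_map_vectors[OF x(2), of u] u x(1) by blast
    then show "eval_poly (\<lambda>(i, c). u i $ c) (minor \<sigma> I) = 0"
      using x(2) sigma by (intro eval_minor_point[OF sigma(1) I, where x = x and l = l]) auto
  qed
  then have "multiview_map n A ` multiview_domain n A \<subseteq> ?Z"
    using multiview_map_in_proj_planes by auto
  moreover have "zariski_closed n ?Z"
    unfolding zariski_closed_def
    using minor_in_polys[OF sigma(1) I] minor_multihomogeneous[OF sigma(1) I]
    by (intro exI[of _ "{minor \<sigma> I}"]) simp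
  ultimately have "multiview_variety n A \<subseteq> ?Z"
    unfolding multiview_variety_def zariski_closure_def by blast
  then show ?thesis
    using minor_in_polys[OF sigma(1) I] by (auto simp: multiview_ideal_def)
qed

text \<open>Nonvanishing blocks put \<open>x\<close> into the domain of the rational map, and the
  scales \<open>l\<close> give arbitrary homogeneous coordinates of its image.\<close>

lemma multiview_ideal_vanishes:
  assumes f: "f \<in> multiview_ideal n A" and x: "x \<in> carrier_vec 4"
    and nz: "\<And>i. i < n \<Longrightarrow> \<exists>c<3. point x (i, c) \<noteq> 0" and l: "\<And>i. i < n \<Longrightarrow> l i \<noteq> 0"
  shows "eval_poly (\<lambda>(i, c). l i * point x (i, c)) f = 0"
proof -
  have "x \<noteq> 0\<^sub>v 4"
    using nz[of 0] two_le point_zero by auto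
  then have "proj_pt x \<in> proj_space 3"
    using x by (auto simp: proj_space_def)
  moreover have "A i *\<^sub>v v \<noteq> 0\<^sub>v 3" if i: "i < n" and v: "v \<in> proj_pt x" for i v
  proof -
    obtain k where k: "k \<noteq> 0" "A i *\<^sub>v v = k \<cdot>\<^sub>v (A i *\<^sub>v x)"
      using image_proj_pt[OF i x] v by blast
    obtain c where c: "c < 3" "point x (i, c) \<noteq> 0"
      using nz[OF i] by blast
    have "(A i *\<^sub>v v) $ c = k * point x (i, c)"
      unfolding k(2) using A_carrier[OF i] c(1) index_image_point[OF i c(1), of x]
      by (simp del: index_mult_mat_vec)
    then show ?thesis
      using k(1) c by auto
  qed
  ultimately have "multiview_map n A (proj_pt x) \<in> multiview_map n A ` multiview_domain n A"
    by (simp add: multiview_domain_def)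
  then have "multiview_map n A (proj_pt x) \<in> multiview_variety n A"
    unfolding multiview_variety_def zariski_closure_def by blast
  then have "vanishes_at n f (multiview_map n A (proj_pt x))"
    using f by (simp add: multiview_ideal_def)
  moreover have "l i \<cdot>\<^sub>v (A i *\<^sub>v x) \<in> multiview_map n A (proj_pt x) i" if "i < n" for i
    using that l[OF that] image_proj_pt[OF that x] by (auto simp: multiview_map_def)
  ultimately have "eval_poly (\<lambda>(i, c). (l i \<cdot>\<^sub>v (A i *\<^sub>v x)) $ c) f = 0"
    unfolding vanishes_at_def by (auto dest!: spec[of _ "\<lambda>i. l i \<cdot>\<^sub>v (A i *\<^sub>v x)"])
  moreover have "eval_poly (\<lambda>(i, c). l i * point x (i, c)) f =
      eval_poly (\<lambda>(i, c). (l i \<cdot>\<^sub>v (A i *\<^sub>v x)) $ c) f"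
  proof (rule eval_poly_cong[where n = n])
    show "f \<in> polys n"
      using f by (simp add: multiview_ideal_def)
    fix i c :: nat assume "i < n" "c < 3"
    then show "(\<lambda>(i, c). l i * point x (i, c)) (i, c) = (\<lambda>(i, c). (l i \<cdot>\<^sub>v (A i *\<^sub>v x)) $ c) (i, c)"
      using A_carrier[of i] index_image_point[of i c x] by (simp del: index_mult_mat_vec)
  qed
  ultimately show ?thesis
    by simp
qed

text \<open>
  If \<open>w i > 0\<close>, take from camera \<open>i\<close> the rows of the \<open>w i\<close> lowest variables and the row of the
  highest variable in \<open>t\<close>; the leading monomial of a minor is the product of the highest
  variables of the chosen rows.
\<close>

lemma leading_monom_of_minor_divides:
  assumes r: "term_order n r" and t: "t \<in> monoms n"
    and high: "4 \<le> (\<Sum>i<n. height (var_rank r) t i)"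
  obtains \<sigma> I s t' where "\<sigma> \<subseteq> {..<n}" "2 \<le> card \<sigma>" "card \<sigma> \<le> 4"
    "I \<subseteq> {..<3 * card \<sigma>}" "card I = card \<sigma> + 4"
    "s \<in> Poly_Mapping.keys (minor \<sigma> I)" "\<And>s'. s' \<in> Poly_Mapping.keys (minor \<sigma> I) \<Longrightarrow> (s', s) \<in> r"
    "t = s + t'" "t' \<in> monoms n"
proof -
  let ?rk = "var_rank r"
  \<comment> \<open>A maximal minor has one row per camera and four more, so the total is cut down
    to exactly 4.\<close>
  obtain w where w: "\<And>i. i < n \<Longrightarrow> w i \<le> height ?rk t i" "(\<Sum>i<n. w i) = 4"
    using sum_nat_below[OF _ high] by auto
  define \<sigma> where "\<sigma> = {i. i < n \<and> 0 < w i}"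
  have \<sigma>: "\<sigma> \<subseteq> {..<n}" and fin: "finite \<sigma>"
    by (auto simp: \<sigma>_def)
  have "\<exists>c. c < 3 \<and> Poly_Mapping.lookup t (i, c) \<noteq> 0 \<and> ?rk i c = height ?rk t i" if "i \<in> \<sigma>" for i
  proof -
    have "0 < height ?rk t i"
      using w(1)[of i] that by (simp add: \<sigma>_def)
    then show ?thesis
      by (rule height_attained) blast
  qed
  then have "\<forall>i\<in>\<sigma>. \<exists>c. c < 3 \<and> Poly_Mapping.lookup t (i, c) \<noteq> 0 \<and> ?rk i c = height ?rk t i"
    by (rule ballI)
  from bchoice[OF this] obtain top where "\<forall>i\<in>\<sigma>. top i < 3 \<and> Poly_Mapping.lookup t (i, top i) \<noteq> 0 \<and>
      ?rk i (top i) = height ?rk t i" ..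
  then have top: "top i < 3 \<and> Poly_Mapping.lookup t (i, top i) \<noteq> 0 \<and>
      ?rk i (top i) = height ?rk t i" if "i \<in> \<sigma>" for i
    using that by (rule bspec)
  define R where "R i = insert (top i) {c. c < 3 \<and> ?rk i c < w i}" for i
  have w_le_top: "w i \<le> ?rk i (top i)" if "i \<in> \<sigma>" for i
    using w(1)[of i] top[OF that] that by (simp add: \<sigma>_def)
  have R_less: "c < 3" if "i \<in> \<sigma>" "c \<in> R i" for i c
    using that top[OF that(1)] by (auto simp: R_def)
  have R_le: "?rk i c \<le> ?rk i (top i)" if "i \<in> \<sigma>" "c \<in> R i" for i c
    using that w_le_top[OF that(1)] by (auto simp: R_def)
  \<comment> \<open>The top variable has rank at least \<open>w i\<close>, so it is not among the
    \<open>w i\<close> lowest ones, and \<open>w i\<close> is at most 2.\<close>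
  have w_less: "w i < 3" and card_R: "card (R i) = Suc (w i)" if i: "i \<in> \<sigma>" for i
  proof -
    have bij: "bij_betw (?rk i) {..<3} {..<3}"
      using bij_betw_var_rank[OF r] i by (simp add: \<sigma>_def)
    then have "?rk i (top i) \<in> {..<3}"
      using bij_betwE top[OF i] by blast
    then show w3: "w i < 3"
      using w_le_top[OF i] by simp
    have "?rk i ` {c. c < 3 \<and> ?rk i c < w i} = {..<w i}"
    proof
      show "{..<w i} \<subseteq> ?rk i ` {c. c < 3 \<and> ?rk i c < w i}"
      proof
        fix k assume k: "k \<in> {..<w i}"
        then have "k \<in> ?rk i ` {..<3}"
          using w3 bij by (simp add: bij_betw_def)
        then show "k \<in> ?rk i ` {c. c < 3 \<and> ?rk i c < w i}"
          using k by auto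
      qed
    qed auto
    moreover have "inj_on (?rk i) {c. c < 3 \<and> ?rk i c < w i}"
      using bij by (auto simp: bij_betw_def inj_on_def)
    ultimately have "card {c. c < 3 \<and> ?rk i c < w i} = w i"
      using card_image by fastforce
    moreover have "top i \<notin> {c. c < 3 \<and> ?rk i c < w i}"
      using w_le_top[OF i] by auto
    ultimately show "card (R i) = Suc (w i)"
      by (simp add: R_def)
  qed
  have sum_w: "(\<Sum>i\<in>\<sigma>. w i) = 4"
    using w(2) by (subst sum.mono_neutral_left[of "{..<n}" \<sigma>]) (auto simp: \<sigma>_def)
  \<comment> \<open>Each \<open>w i\<close> on \<open>\<sigma>\<close> is 1 or 2 and the total is 4,
    which forces two to four cameras.\<close>
  have "card \<sigma> \<le> (\<Sum>i\<in>\<sigma>. w i)"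
    using sum_mono[of \<sigma> "\<lambda>i. 1" w] by (simp add: \<sigma>_def Suc_le_eq)
  moreover have "(\<Sum>i\<in>\<sigma>. w i) \<le> card \<sigma> * 2"
    using sum_bounded_above[of \<sigma> w 2] w_less by fastforce
  ultimately have card_\<sigma>: "2 \<le> card \<sigma>" "card \<sigma> \<le> 4"
    using sum_w by auto
  let ?cam = "\<lambda>j. sorted_list_of_set \<sigma> ! j"
  have "bij_betw ?cam {..<card \<sigma>} \<sigma>"
    using bij_betw_nth[of "sorted_list_of_set \<sigma>" "{..<card \<sigma>}" \<sigma>] fin by simp
  note cam = this bij_betwE[OF this]
  define I where "I = (\<lambda>(j, c). 3 * j + c) ` Sigma {..<card \<sigma>} (\<lambda>j. R (?cam j))"
  have in_I: "3 * j + c \<in> I \<longleftrightarrow> c \<in> R (?cam j)" if "j < card \<sigma>" "c < 3" for j c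
  proof
    assume "3 * j + c \<in> I"
    then obtain j' c' where jc: "3 * j + c = 3 * j' + c'" "j' < card \<sigma>" "c' \<in> R (?cam j')"
      by (auto simp: I_def)
    then have "c' < 3"
      using R_less cam(2) by auto
    then have "j = j'" "c = c'"
      using jc(1) that(2) by presburger+
    then show "c \<in> R (?cam j)"
      using jc(3) by simp
  qed (use that in \<open>auto simp: I_def\<close>)
  have I_sub: "I \<subseteq> {..<3 * card \<sigma>}"
  proof
    fix q assume "q \<in> I"
    then obtain j c where jc: "q = 3 * j + c" "j < card \<sigma>" "c \<in> R (?cam j)"
      by (auto simp: I_def)
    then have "c < 3"
      using R_less cam(2) by auto
    then show "q \<in> {..<3 * card \<sigma>}"
      using jc by simp
  qed
  have "inj_on (\<lambda>(j, c). 3 * j + c) (Sigma {..<card \<sigma>} (\<lambda>j. R (?cam j)))"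
  proof (rule inj_on_inverseI[where g = "\<lambda>q. (q div 3, q mod 3)"])
    fix v assume "v \<in> Sigma {..<card \<sigma>} (\<lambda>j. R (?cam j))"
    then obtain j c where v: "v = (j, c)" "j < card \<sigma>" "c \<in> R (?cam j)"
      by auto
    then have "c < 3"
      using R_less cam(2) by auto
    then show "((case v of (j, c) \<Rightarrow> 3 * j + c) div 3, (case v of (j, c) \<Rightarrow> 3 * j + c) mod 3) = v"
      by (simp add: v(1))
  qed
  then have "card I = (\<Sum>j<card \<sigma>. card (R (?cam j)))"
    unfolding I_def using R_def by (subst card_image) auto
  also have "\<dots> = (\<Sum>i\<in>\<sigma>. card (R i))"
    by (rule sum.reindex_bij_betw[OF cam(1)])
  also have "\<dots> = (\<Sum>i\<in>\<sigma>. w i + 1)"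
    by (rule sum.cong) (simp_all add: card_R)
  also have "\<dots> = card \<sigma> + 4"
    by (simp only: sum.distrib sum_w) simp
  finally have card_I: "card I = card \<sigma> + 4" .
  define s where "s = (\<Sum>j<card \<sigma>. Poly_Mapping.single (?cam j, top (?cam j)) (1 :: nat))"
  have s: "s = (\<Sum>i\<in>\<sigma>. Poly_Mapping.single (i, top i) 1)"
    unfolding s_def by (rule sum.reindex_bij_betw[OF cam(1)])
  have "s \<in> Poly_Mapping.keys (minor \<sigma> I)"
    unfolding s_def
  proof (rule monom_in_keys_minor[OF \<sigma> I_sub card_I])
    fix j assume j: "j < card \<sigma>"
    then have "top (?cam j) < 3"
      using top cam(2) by auto
    then show "top (?cam j) < 3 \<and> 3 * j + top (?cam j) \<in> I"
      using in_I[OF j] by (simp add: R_def)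
  qed
  moreover have "(s', s) \<in> r" if s': "s' \<in> Poly_Mapping.keys (minor \<sigma> I)" for s'
  proof -
    obtain c where c: "s' = (\<Sum>j<card \<sigma>. Poly_Mapping.single (?cam j, c j) 1)"
      "\<And>j. j < card \<sigma> \<Longrightarrow> c j < 3 \<and> 3 * j + c j \<in> I"
      using keys_minor[OF \<sigma> I_sub card_I s'] by blast
    show ?thesis
      unfolding c(1) s_def
    proof (rule term_order_sum[OF r])
      fix j assume "j \<in> {..<card \<sigma>}"
      then have j: "j < card \<sigma>" "?cam j \<in> \<sigma>" "?cam j < n"
        using cam(2) \<sigma> by auto
      have cj: "c j < 3" "c j \<in> R (?cam j)"
        using c(2)[OF j(1)] in_I[OF j(1)] by auto
      show "Poly_Mapping.single (?cam j, c j) 1 \<in> monoms n"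
        "Poly_Mapping.single (?cam j, top (?cam j)) 1 \<in> monoms n"
        using j(3) cj(1) top[OF j(2)] by (simp_all add: monoms_single)
      show "(Poly_Mapping.single (?cam j, c j) 1, Poly_Mapping.single (?cam j, top (?cam j)) 1) \<in> r"
        using j cj top[OF j(2)] R_le[OF j(2) cj(2)] by (intro var_rank_le_imp[OF r]) auto
    qed simp
  qed
  \<comment> \<open>\<open>s\<close> contains each of its variables once, and all of them occur in
    \<open>t\<close>.\<close>
  moreover have "t = s + (t - s)"
  proof (rule monom_divides)
    fix v :: "nat \<times> nat"
    obtain i c where v: "v = (i, c)"
      by force
    show "Poly_Mapping.lookup s v \<le> Poly_Mapping.lookup t v"
      unfolding s v lookup_sum_single[OF fin] using top[of i] by auto
  qed
  ultimately show thesis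
    using \<sigma> card_\<sigma> I_sub card_I monoms_diff[OF t] by (intro that) auto
qed

text \<open>One inclusion of initial ideals comes from \<open>G\<close> lying in the multiview
  ideal. For the other, leading monomials in the ideal have total height at least 4 and are thus
  divisible by leading monomials of minors.\<close>

lemma universal_groebner_basis_minors:
  assumes inf: "infinite (UNIV :: 'k set)"
  defines "G \<equiv> \<Union>\<sigma>\<in>{\<sigma>. \<sigma> \<subseteq> {..<n} \<and> 2 \<le> card \<sigma> \<and> card \<sigma> \<le> 4}. maximal_minors A \<sigma>"
  shows "universal_groebner_basis n G (multiview_ideal n A)"
proof -
  have minor_in_G: "minor \<sigma> I \<in> G" if "\<sigma> \<subseteq> {..<n}" "2 \<le> card \<sigma>" "card \<sigma> \<le> 4"
    "I \<subseteq> {..<3 * card \<sigma>}" "card I = card \<sigma> + 4" for \<sigma> I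
    using that unfolding G_def maximal_minors_eq by blast
  have G_sub: "G \<subseteq> multiview_ideal n A"
  proof
    fix m assume "m \<in> G"
    then obtain \<sigma> I where "m = minor \<sigma> I" "\<sigma> \<subseteq> {..<n}" "2 \<le> card \<sigma>"
      "I \<subseteq> {..<3 * card \<sigma>}" "card I = card \<sigma> + 4"
      unfolding G_def maximal_minors_eq by blast
    then show "m \<in> multiview_ideal n A"
      by (auto intro!: minor_in_multiview_ideal)
  qed
  have "initial_ideal n r G = initial_ideal n r (multiview_ideal n A)" if r: "term_order n r" for r
  proof -
    let ?R = "poly_ring n :: 'k mpoly ring"
    let ?J = "multiview_ideal n A"
    interpret R: cring ?R
      by (rule cring_poly_ring)
    have lead: "\<exists>t\<in>Poly_Mapping.keys f. \<forall>s\<in>Poly_Mapping.keys f. (s, t) \<in> r"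
      if "f \<in> ?J - {0}" for f
      using that by (intro term_order_max[OF r]) (auto simp: multiview_ideal_def polys_def)
    have lead_carrier: "initial_monom r f \<in> carrier ?R" if f: "f \<in> ?J - {0}" for f
    proof -
      obtain t where t: "t \<in> Poly_Mapping.keys f" "\<forall>s\<in>Poly_Mapping.keys f. (s, t) \<in> r"
        using lead[OF f] by blast
      then have "initial_monom r f = Poly_Mapping.single t 1"
        by (intro initial_monomI[OF r]) auto
      moreover have "t \<in> monoms n"
        using f t(1) by (auto simp: multiview_ideal_def polys_def)
      ultimately show ?thesis
        by (simp add: poly_ring_def polys_def)
    qed
    have car: "initial_monom r ` (G - {0}) \<subseteq> carrier ?R" "initial_monom r ` (?J - {0}) \<subseteq> carrier ?R"
      using lead_carrier G_sub by auto
    show ?thesis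
    proof
      have "initial_monom r ` (G - {0}) \<subseteq> initial_ideal n r ?J"
        using R.genideal_self[OF car(2)] G_sub unfolding initial_ideal_def by blast
      then show "initial_ideal n r G \<subseteq> initial_ideal n r ?J"
        unfolding initial_ideal_def[of n r G]
        by (intro R.genideal_minimal) (simp_all add: initial_ideal_def R.genideal_ideal[OF car(2)])
    next
      have ideal: "ideal (initial_ideal n r G) ?R"
        unfolding initial_ideal_def by (rule R.genideal_ideal[OF car(1)])
      have "initial_monom r f \<in> initial_ideal n r G" if f: "f \<in> ?J - {0}" for f
      proof -
        obtain t where t: "t \<in> Poly_Mapping.keys f" "\<And>s. s \<in> Poly_Mapping.keys f \<Longrightarrow> (s, t) \<in> r"
          using lead[OF f] by blast
        have fp: "f \<in> polys n"
          using f by (simp add: multiview_ideal_def)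
        have tM: "t \<in> monoms n"
          using fp t(1) by (auto simp: polys_def)
        have "4 \<le> (\<Sum>i<n. height (var_rank r) t i)"
        proof (rule initial_monom_not_low[where V = "point ` carrier_vec 4", OF inf _ _ _ _ r _ fp _ t])
          show "(\<lambda>v. 0) \<in> point ` carrier_vec 4"
            using point_zero by (intro image_eqI[of _ _ "0\<^sub>v 4"]) simp_all
          show "(\<lambda>v. a v + x * b v) \<in> point ` carrier_vec 4"
            if ab: "a \<in> point ` carrier_vec 4" "b \<in> point ` carrier_vec 4" for a b x
          proof -
            obtain y z where "y \<in> carrier_vec 4" "z \<in> carrier_vec 4" "a = point y" "b = point z"
              using ab by blast
            then show ?thesis
              by (intro image_eqI[of _ _ "y + x \<cdot>\<^sub>v z"]) (simp_all add: point_linear)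
          qed
          show "\<exists>a\<in>point ` carrier_vec 4. a j = 1 \<and> (\<forall>j'\<in>J - {j}. a j' = 0)"
            if "J \<subseteq> {..<n} \<times> {..<3}" "card J \<le> 4" "j \<in> J" for J j
            using that by (rule point_dual)
          show "bij_betw (var_rank r i) {..<3} {..<3}" if "i < n" for i
            using r that by (rule bij_betw_var_rank)
          fix t assume t: "t \<in> monoms n" "\<not> (\<Sum>i<n. height (var_rank r) t i) < 4"
          obtain \<sigma> I s t' where m: "\<sigma> \<subseteq> {..<n}" "2 \<le> card \<sigma>" "card \<sigma> \<le> 4"
            "I \<subseteq> {..<3 * card \<sigma>}" "card I = card \<sigma> + 4"
            "s \<in> Poly_Mapping.keys (minor \<sigma> I)" "\<And>s'. s' \<in> Poly_Mapping.keys (minor \<sigma> I) \<Longrightarrow> (s', s) \<in> r"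
            "t = s + t'" "t' \<in> monoms n"
            using leading_monom_of_minor_divides[OF r t(1)] t(2) by (metis not_less)
          \<comment> \<open>With all scales equal to 1 the minor is a relation on \<open>V\<close>,
            as required for the rewriting of monomials that are not low.\<close>
          have "eval_poly a (minor \<sigma> I) = 0" if "a \<in> point ` carrier_vec 4" for a
            using that m(2) by (auto intro!: eval_minor_point[OF m(1,4,5), where l = "\<lambda>i. 1"])
          then show "\<exists>m s t'. s \<in> Poly_Mapping.keys m \<and> t = s + t' \<and> t' \<in> monoms n \<and>
            (\<forall>s'\<in>Poly_Mapping.keys m. (s', s) \<in> r \<and> s' \<in> monoms n \<and> (\<forall>i<n. block_deg s' i = block_deg s i)) \<and>
            (\<forall>a\<in>point ` carrier_vec 4. eval_poly a m = 0)"
            using m(6-9) keys_minor_monoms[OF m(1,4,5)]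
            by (intro exI[of _ "minor \<sigma> I"] exI[of _ s] exI[of _ t']) auto
        next
          fix a and l :: "nat \<Rightarrow> 'k"
          assume "a \<in> point ` carrier_vec 4" "\<And>i. i < n \<Longrightarrow> \<exists>c<3. a (i, c) \<noteq> 0" "\<And>i. i < n \<Longrightarrow> l i \<noteq> 0"
          then show "eval_poly (\<lambda>(i, c). l i * a (i, c)) f = 0"
            using f multiview_ideal_vanishes by auto
        qed
        then obtain \<sigma> I s t' where m: "\<sigma> \<subseteq> {..<n}" "2 \<le> card \<sigma>" "card \<sigma> \<le> 4"
          "I \<subseteq> {..<3 * card \<sigma>}" "card I = card \<sigma> + 4"
          "s \<in> Poly_Mapping.keys (minor \<sigma> I)" "\<And>s'. s' \<in> Poly_Mapping.keys (minor \<sigma> I) \<Longrightarrow> (s', s) \<in> r"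
          "t = s + t'" "t' \<in> monoms n"
          using leading_monom_of_minor_divides[OF r tM] by metis
        have "minor \<sigma> I \<in> G - {0}"
          using minor_in_G[OF m(1-5)] m(6) by auto
        then have "initial_monom r (minor \<sigma> I) \<in> initial_ideal n r G"
          unfolding initial_ideal_def using R.genideal_self[OF car(1)] by blast
        then have "Poly_Mapping.single s 1 \<in> initial_ideal n r G"
          using initial_monomI[OF r m(6,7)] by simp
        moreover have "Poly_Mapping.single t' 1 \<in> carrier ?R"
          using m(9) by (simp add: poly_ring_def polys_def)
        \<comment> \<open>The leading monomial of \<open>f\<close> is that of the minor times the
          cofactor \<open>t'\<close>.\<close>
        ultimately have "Poly_Mapping.single s 1 \<otimes>\<^bsub>?R\<^esub> Poly_Mapping.single t' 1 \<in> initial_ideal n r G"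
          by (rule ideal.I_r_closed[OF ideal])
        then show ?thesis
          using initial_monomI[OF r t] m(8) by (simp add: poly_ring_def mult_single)
      qed
      then show "initial_ideal n r ?J \<subseteq> initial_ideal n r G"
        unfolding initial_ideal_def[of n r ?J] by (intro R.genideal_minimal[OF ideal]) auto
    qed
  qed
  then show ?thesis
    using G_sub by (simp add: universal_groebner_basis_def groebner_basis_def)
qed

end

theorem theorem2p1:
  fixes A :: "nat \<Rightarrow> 'k::alg_closed_field mat" and n :: nat
  assumes "n \<ge> 2"
    and "\<And>i. i < n \<Longrightarrow> A i \<in> carrier_mat 3 4"
    and "\<And>i. i < n \<Longrightarrow> vec_space.rank 3 (A i) = 3"
    and "generic n A"
  shows "universal_groebner_basis n
    (\<Union>\<sigma>\<in>{\<sigma>. \<sigma> \<subseteq> {..<n} \<and> 2 \<le> card \<sigma> \<and> card \<sigma> \<le> 4}. maximal_minors A \<sigma>)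
    (multiview_ideal n A)"
proof -
  interpret generic_cameras n A
    using assms by unfold_locales auto
  show ?thesis
    by (rule universal_groebner_basis_minors[OF infinite_UNIV_alg_closed])
qed

end
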